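(* Let $c\geq 1$ be a constant. The class of graphs $G$ that admit a drawing in the plane with at most $c$ crossings per edge has bounded expansion. Precisely, there is an absolute constant $K$ such that $\widetilde{\nabla}_d(G)\leq K\sqrt{cd}$ for every such $c$, every graph $G$ that admits a drawing with at most $c$ crossings per edge, and every integer $d\geq 1$.
   Context: All graphs are finite and simple; densities are taken over graphs with at least one vertex. $|G|$ is the number of vertices and $\|G\|$ the number of edges of $G$. Bounded expansion: for $d\in\mathbb N$, a graph $H$ is a shallow minor of $G$ at depth $d$ if there is a subgraph $X$ of $G$ whose connected components each have radius at most $d$, such that $H$ is a simple graph obtained from $G$ by contracting each component of $X$ into a single vertex and then taking a subgraph. (The radius of a connected graph is the minimum over vertices $r$ of the maximum distance from $r$ to another vertex.) For a class $\mathcal C$, let $\nabla_d(\mathcal C)=\sup \|H\|/|H|$, the supremum over all shallow minors $H$ at depth $d$ of graphs in $\mathcal C$. The class $\mathcal C$ has bounded expansion if there is a function $f:\mathbb N\to\mathbb R$ with $\nabla_d(\mathcal C)\leq f(d)$ for all $d\in\mathbb N$. Topological grad: a $(\leq t)$-subdivision of $H$ is a graph obtained from $H$ by replacing each edge $vw$ by a path between $v$ and $w$ with at most $t$ internal (new) vertices. $H$ is a shallow topological minor of $G$ at depth $d$ if some $(\leq 2d)$-subdivision of $H$ is isomorphic to a subgraph of $G$. $\widetilde{\nabla}_d(G)$ is the supremum of $\|H\|/|H|$ over all shallow topological minors $H$ of $G$ at depth $d$. *)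

theory Defs
  imports "HOL-Analysis.Analysis"
begin

section \<open>Finite simple graphs\<close>

record 'v ugraph =
  verts :: "'v set"
  edges :: "'v set set"

definition simple_graph :: "'v ugraph \<Rightarrow> bool" where
  "simple_graph G \<longleftrightarrow> finite (verts G) \<and> (\<forall>e\<in>edges G. e \<subseteq> verts G \<and> card e = 2)"

definition subgraph :: "'v ugraph \<Rightarrow> 'v ugraph \<Rightarrow> bool" where
  "subgraph X G \<longleftrightarrow> simple_graph X \<and> verts X \<subseteq> verts G \<and> edges X \<subseteq> edges G"

definition isomorphic :: "'v ugraph \<Rightarrow> 'w ugraph \<Rightarrow> bool" where
  "isomorphic G H \<longleftrightarrow>
     (\<exists>\<phi>. bij_betw \<phi> (verts G) (verts H) \<and> edges H = (\<lambda>e. \<phi> ` e) ` edges G)"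

definition density :: "'v ugraph \<Rightarrow> real" where
  "density G = real (card (edges G)) / real (card (verts G))"


section \<open>Shallow minors and bounded expansion\<close>

definition adj :: "'v ugraph \<Rightarrow> 'v \<Rightarrow> 'v \<Rightarrow> bool" where
  "adj G u v \<longleftrightarrow> {u, v} \<in> edges G"

definition induced :: "'v ugraph \<Rightarrow> 'v set \<Rightarrow> 'v ugraph" where
  "induced G C = \<lparr>verts = C, edges = {e \<in> edges G. e \<subseteq> C}\<rparr>"

definition graph_components :: "'v ugraph \<Rightarrow> 'v ugraph set" where
  "graph_components G = (\<lambda>u. induced G {v. (adj G)\<^sup>*\<^sup>* u v}) ` verts G"

definition graph_dist :: "'v ugraph \<Rightarrow> 'v \<Rightarrow> 'v \<Rightarrow> nat" where
  "graph_dist G u v = (LEAST n. (adj G ^^ n) u v)"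

text \<open>Only meaningful for finite, nonempty, connected graphs.\<close>

definition graph_radius :: "'v ugraph \<Rightarrow> nat" where
  "graph_radius G = (MIN r\<in>verts G. MAX v\<in>verts G. graph_dist G r v)"

text \<open>
  The vertices of the contraction are the vertex sets of the components of \<open>X\<close>, together with
  a singleton for every vertex of \<open>G\<close> outside \<open>X\<close>, which is left uncontracted.  Loops and
  parallel edges are discarded.
\<close>

definition contract :: "'v ugraph \<Rightarrow> 'v ugraph \<Rightarrow> 'v set ugraph" where
  "contract G X =
     (let B = verts ` graph_components X \<union> (\<lambda>v. {v}) ` (verts G - verts X)
      in \<lparr>verts = B,
          edges = {{P, Q} |P Q. P \<in> B \<and> Q \<in> B \<and> P \<noteq> Q \<and> (\<exists>p\<in>P. \<exists>q\<in>Q. adj G p q)}\<rparr>)"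

definition shallow_minor :: "nat \<Rightarrow> 'v set ugraph \<Rightarrow> 'v ugraph \<Rightarrow> bool" where
  "shallow_minor d H G \<longleftrightarrow>
     (\<exists>X. subgraph X G \<and> (\<forall>C\<in>graph_components X. graph_radius C \<le> d) \<and> subgraph H (contract G X))"

definition grad :: "nat \<Rightarrow> 'v ugraph set \<Rightarrow> ereal" where
  "grad d \<C> = (SUP H\<in>{H. verts H \<noteq> {} \<and> (\<exists>G\<in>\<C>. shallow_minor d H G)}. ereal (density H))"

definition bounded_expansion :: "'v ugraph set \<Rightarrow> bool" where
  "bounded_expansion \<C> \<longleftrightarrow> (\<exists>f :: nat \<Rightarrow> real. \<forall>d. grad d \<C> \<le> ereal (f d))"


section \<open>Shallow topological minors\<close>

definition path_edges :: "'v list \<Rightarrow> 'v set set" where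
  "path_edges xs = {{xs ! i, xs ! Suc i} |i. Suc i < length xs}"

text \<open>
  \<open>P e\<close> lists the vertices, both ends included, of the path that replaces the edge \<open>e\<close>; at most
  \<open>t\<close> internal vertices means length at most \<open>t + 2\<close>.
\<close>

definition subdivision_le :: "nat \<Rightarrow> 'v ugraph \<Rightarrow> 'v ugraph \<Rightarrow> bool" where
  "subdivision_le t H S \<longleftrightarrow>
     (\<exists>P :: 'v set \<Rightarrow> 'v list.
        (\<forall>e\<in>edges H. P e \<noteq> [] \<and> distinct (P e) \<and> {hd (P e), last (P e)} = e \<and>
            length (P e) \<le> t + 2 \<and> set (P e) \<inter> verts H = e) \<and>
        (\<forall>e\<in>edges H. \<forall>f\<in>edges H. e \<noteq> f \<longrightarrow> set (P e) \<inter> set (P f) \<subseteq> verts H) \<and>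
        verts S = verts H \<union> (\<Union>e\<in>edges H. set (P e)) \<and>
        edges S = (\<Union>e\<in>edges H. path_edges (P e)))"

definition shallow_topological_minor :: "nat \<Rightarrow> 'w ugraph \<Rightarrow> 'v ugraph \<Rightarrow> bool" where
  "shallow_topological_minor d H G \<longleftrightarrow>
     simple_graph H \<and>
     (\<exists>S F. subdivision_le (2 * d) H S \<and> subgraph F G \<and> isomorphic S F)"

text \<open>
  Topological minors are taken up to isomorphism, so \<open>H\<close> may be assumed to live on the natural
  numbers, where new subdivision vertices are always available.
\<close>

definition topological_grad :: "nat \<Rightarrow> 'v ugraph \<Rightarrow> ereal" where
  "topological_grad d G =
     (SUP H\<in>{H :: nat ugraph. verts H \<noteq> {} \<and> shallow_topological_minor d H G}. ereal (density H))"


section \<open>Drawings in the plane\<close>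

text \<open>
  Vertices are distinct points of the plane and edges are simple arcs that join the points of
  their ends and contain no other vertex.
\<close>

definition drawing :: "'v ugraph \<Rightarrow> ('v \<Rightarrow> complex) \<Rightarrow> ('v set \<Rightarrow> real \<Rightarrow> complex) \<Rightarrow> bool" where
  "drawing G p \<gamma> \<longleftrightarrow>
     inj_on p (verts G) \<and>
     (\<forall>e\<in>edges G. arc (\<gamma> e) \<and> {pathstart (\<gamma> e), pathfinish (\<gamma> e)} = p ` e \<and>
         path_image (\<gamma> e) \<inter> p ` verts G = p ` e)"

text \<open>
  The crossings on an edge \<open>e\<close>: a crossing is a common point, other than a vertex, of \<open>e\<close> and another
  edge \<open>f\<close>.  Crossings are recorded as pairs \<open>(f, x)\<close>, so a point where \<open>e\<close> meets several
  other edges counts once for each of them; tangential contacts count as well.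
\<close>

definition crossings ::
  "'v ugraph \<Rightarrow> ('v \<Rightarrow> complex) \<Rightarrow> ('v set \<Rightarrow> real \<Rightarrow> complex) \<Rightarrow> 'v set \<Rightarrow> ('v set \<times> complex) set" where
  "crossings G p \<gamma> e =
     {(f, x). f \<in> edges G \<and> f \<noteq> e \<and> x \<in> path_image (\<gamma> e) \<inter> path_image (\<gamma> f) - p ` verts G}"

definition drawable_with_crossings_per_edge :: "real \<Rightarrow> 'v ugraph \<Rightarrow> bool" where
  "drawable_with_crossings_per_edge c G \<longleftrightarrow>
     (\<exists>p \<gamma>. drawing G p \<gamma> \<and>
        (\<forall>e\<in>edges G. finite (crossings G p \<gamma> e) \<and> real (card (crossings G p \<gamma> e)) \<le> c))"

text \<open>
  The vertex type \<open>'v\<close> is arbitrary.  Over an infinite type such as \<open>nat\<close>, which contains a copy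
  of every finite graph, this is the class of all finite simple graphs with such a drawing.
\<close>

definition crossing_class :: "real \<Rightarrow> 'v ugraph set" where
  "crossing_class c = {G. simple_graph G \<and> drawable_with_crossings_per_edge c G}"

end

theory Submission
  imports Defs
begin

text \<open>
  The key fact is a planarity statement that tolerates crossings of adjacent edges: if the edges of a
  graph are drawn as connected subsets of the plane that meet exactly when the edges have a common end, then
  the graph has at most $2^{15}$ times as many edges as vertices (\<open>independence_drawing_linear\<close>).
  A denser graph would have a large complete minor (\<open>complete_minor_of_dense\<close>).  Grouping its
  branch sets yields a $K_{3,3}$ minor whose nine edges are pairwise disjoint and therefore drawn as
  disjoint sets.  The drawing then realises $K_{3,3}$ by connected sets in the plane, which a theta
  curve, the Jordan curve theorem and Janiszewski's theorem exclude (\<open>no_planar_K33_model\<close>).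

  Let $G$ be drawn with at most $c$ crossings per edge.  An edge of a shallow minor or
  shallow topological minor at depth $d$ is drawn as the union of the arcs of at most $2d + 1$ edges of $G$.  The
  images of two independent edges of the minor meet only if an edge of $G$ on one route crosses an edge on
  the other.  It remains to remove such crossings at a small cost, by random sampling.

  For topological minors distinct edges have disjoint routes, so a minor with $m$ edges and $n$ vertices
  has at most $(2d+1)cm$ crossing pairs of independent edges, and the averaging argument of the
  crossing lemma gives $m = O(\sqrt{cd}\, n)$ (\<open>routed_disjoint_bound\<close>).  The usual proof of the crossing
  lemma first redraws the graph so that adjacent edges do not cross; since such crossings are
  tolerated here, the given drawing serves as it is.

  For shallow minors, routes in the same branch set overlap.  A random set of edges of $G$ is kept, and
  with probability at least $2^{-(2d+1)(c+1)}$ a route is kept while everything that crosses it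
  from outside is not.  The surviving edges satisfy the key fact, which bounds the density by
  $2^{15} \cdot 2^{(2d+1)(c+1)}$ (\<open>routed_bound\<close>).
\<close>

section \<open>Arcs and tripods in the plane\<close>

text \<open>
  The degenerate case of a single point is allowed, because an arc that is cut off where it
  first meets a set, or a leg of a tripod, may shrink to its end.
\<close>

definition arc_between :: "complex \<Rightarrow> complex \<Rightarrow> complex set \<Rightarrow> bool" where
  "arc_between p q K \<longleftrightarrow>
     p = q \<and> K = {p} \<or> (\<exists>g. arc g \<and> pathstart g = p \<and> pathfinish g = q \<and> path_image g = K)"

lemma arc_between_ends: "arc_between p q K \<Longrightarrow> p \<in> K \<and> q \<in> K"
  unfolding arc_between_def by auto

lemma arc_between_sym: "arc_between p q K \<Longrightarrow> arc_between q p K"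
  unfolding arc_between_def
  by (metis arc_reversepath path_image_reversepath pathfinish_reversepath pathstart_reversepath)

lemma arc_between_compact: "arc_between p q K \<Longrightarrow> compact K"
  unfolding arc_between_def by (auto simp: compact_arc_image)

lemma arc_between_path_connected: "arc_between p q K \<Longrightarrow> path_connected K"
  unfolding arc_between_def by (auto simp: path_connected_path_image arc_imp_path)

lemma arc_between_join:
  assumes "arc_between p q K" "arc_between q r L" "K \<inter> L = {q}"
  shows "arc_between p r (K \<union> L)"
proof (cases "p = q \<and> K = {p} \<or> q = r \<and> L = {q}")
  case True
  then show ?thesis using assms arc_between_ends[OF assms(1)] arc_between_ends[OF assms(2)]
    by (auto simp: insert_absorb)
next
  case False
  then obtain g h where "arc g" "pathstart g = p" "pathfinish g = q" "path_image g = K"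
      "arc h" "pathstart h = q" "pathfinish h = r" "path_image h = L"
    using assms(1,2) unfolding arc_between_def by blast
  then have "arc (g +++ h) \<and> pathstart (g +++ h) = p \<and> pathfinish (g +++ h) = r
      \<and> path_image (g +++ h) = K \<union> L"
    using assms(3) by (simp add: arc_join path_image_join)
  then show ?thesis unfolding arc_between_def by blast
qed

lemma arc_between_subpath:
  assumes "arc g" "u \<in> {0..1}" "v \<in> {0..1}" "u \<le> v"
  shows "arc_between (g u) (g v) (g ` {u..v})"
proof (cases "u = v")
  case True
  then show ?thesis by (simp add: arc_between_def)
next
  case False
  then show ?thesis
    unfolding arc_between_def using assms arc_subpath_arc[of g u v]
    by (intro disjI2 exI[of _ "subpath u v g"]) (auto simp: path_image_subpath)
qed

lemma arc_between_split:
  assumes "arc_between p q K" "x \<in> K"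
  obtains K1 K2 where "arc_between p x K1" "arc_between x q K2" "K1 \<union> K2 = K" "K1 \<inter> K2 = {x}"
proof (cases "p = q \<and> K = {p}")
  case True
  then show ?thesis using that[of "{x}" "{x}"] assms by (auto simp: arc_between_def)
next
  case False
  then obtain g where g: "arc g" "pathstart g = p" "pathfinish g = q" "path_image g = K"
    using assms(1) unfolding arc_between_def by blast
  then obtain t where t: "t \<in> {0..1}" "g t = x" using assms(2) by (auto simp: path_image_def)
  have inj: "inj_on g {0..1}" using g(1) by (simp add: arc_def)
  show ?thesis
  proof (rule that)
    show "arc_between p x (g ` {0..t})"
      using arc_between_subpath[OF g(1), of 0 t] t g(2) by (simp add: pathstart_def)
    show "arc_between x q (g ` {t..1})"
      using arc_between_subpath[OF g(1), of t 1] t g(3) by (simp add: pathfinish_def)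
    show "g ` {0..t} \<union> g ` {t..1} = K"
      using t by (simp add: g(4)[symmetric] path_image_def image_Un[symmetric] ivl_disj_un)
    have "g ` {0..t} \<inter> g ` {t..1} = g ` ({0..t} \<inter> {t..1})"
      using t by (intro inj_on_image_Int[OF inj, symmetric]) auto
    also have "{0..t} \<inter> {t..1} = {t}" using t by auto
    finally show "g ` {0..t} \<inter> g ` {t..1} = {x}" using t by simp
  qed
qed

lemma arc_between_first_hit:
  assumes "arc_between p q K" "closed C" "q \<in> C"
  obtains x K' where "arc_between p x K'" "K' \<subseteq> K" "K' \<inter> C = {x}"
proof (cases "p = q \<and> K = {p}")
  case True
  then show ?thesis using that[of q "{q}"] assms by (auto simp: arc_between_def)
next
  case False
  then obtain g where g: "arc g" "pathstart g = p" "pathfinish g = q" "path_image g = K"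
    using assms(1) unfolding arc_between_def by blast
  define T where "T = {0..1} \<inter> g -` C"
  have cont: "continuous_on {0..1} g" using g(1) by (simp add: arc_def path_def)
  have "closed T" unfolding T_def
    using continuous_closed_preimage[OF cont closed_real_atLeastAtMost assms(2)] .
  then have "compact T"
    using bounded_subset[of "{0..1::real}" T] by (auto simp: T_def compact_eq_bounded_closed)
  moreover have "1 \<in> T" using g(3) assms(3) by (simp add: T_def pathfinish_def)
  ultimately obtain t where t: "t \<in> T" "\<And>s. s \<in> T \<Longrightarrow> t \<le> s"
    using compact_attains_inf[of T] by blast
  show ?thesis
  proof (rule that)
    show "arc_between p (g t) (g ` {0..t})"
      using arc_between_subpath[OF g(1), of 0 t] t g(2) by (simp add: pathstart_def T_def)
    show "g ` {0..t} \<subseteq> K" using t g(4) by (auto simp: T_def path_image_def)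
    show "g ` {0..t} \<inter> C = {g t}" using t by (force simp: T_def)
  qed
qed

lemma arc_between_exists:
  assumes "path_connected S" "x \<in> S" "y \<in> S"
  obtains K where "arc_between x y K" "K \<subseteq> S"
  using assms unfolding path_connected_arcwise arc_between_def
  by (cases "x = y") (blast, metis)

text \<open>
  Join $x$ and $y$ by an arc and follow an arc from $z$ until it first meets the former; the
  meeting point is the centre of the tripod.  In this way an arbitrary path-connected set can play
  the role of a vertex of degree 3 in a drawing by arcs.
\<close>

lemma tripod_exists:
  assumes "path_connected S" "x \<in> S" "y \<in> S" "z \<in> S"
  obtains p X Y Z where "arc_between p x X" "arc_between p y Y" "arc_between p z Z"
    "X \<subseteq> S" "Y \<subseteq> S" "Z \<subseteq> S" "X \<inter> Y = {p}" "X \<inter> Z = {p}" "Y \<inter> Z = {p}"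
proof -
  obtain K where K: "arc_between x y K" "K \<subseteq> S" using arc_between_exists assms by metis
  obtain L where L: "arc_between z x L" "L \<subseteq> S" using arc_between_exists assms by metis
  have "closed K" using arc_between_compact[OF K(1)] by (rule compact_imp_closed)
  then obtain p Z where Z: "arc_between z p Z" "Z \<subseteq> L" "Z \<inter> K = {p}"
    using arc_between_first_hit[OF L(1)] arc_between_ends[OF K(1)] by metis
  then have "p \<in> K" by blast
  then obtain X Y where XY: "arc_between x p X" "arc_between p y Y" "X \<union> Y = K" "X \<inter> Y = {p}"
    using arc_between_split[OF K(1)] by metis
  show ?thesis
  proof (rule that[of p X Y Z])
    show "X \<inter> Z = {p}" "Y \<inter> Z = {p}" using XY Z by blast+
  qed (use XY Z K L in \<open>auto intro: arc_between_sym\<close>)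
qed

section \<open>Theta curves and the nonplanarity of the complete bipartite graph on 3 + 3 vertices\<close>

text \<open>
  The Jordan curve theorem, in the form needed for a theta curve: the third arc is connected,
  hence lies on one of the two sides of the closed curve formed by the first two.
\<close>

lemma theta_sides:
  assumes c1: "arc_between p q c1" and c2: "arc_between p q c2" and c3: "arc_between p q c3"
    and "p \<noteq> q" and c12: "c1 \<inter> c2 = {p,q}" and c13: "c1 \<inter> c3 = {p,q}" and c23: "c2 \<inter> c3 = {p,q}"
  obtains I J where "- (c1 \<union> c2) = I \<union> J" "I \<inter> J = {}" "open I" "open J" "connected I" "connected J"
    "J \<noteq> {}" "frontier J = c1 \<union> c2" "c3 - {p,q} \<subseteq> I"
proof -
  obtain g1 where g1: "arc g1" "pathstart g1 = p" "pathfinish g1 = q" "path_image g1 = c1"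
    using c1 \<open>p \<noteq> q\<close> unfolding arc_between_def by blast
  obtain g2 where g2: "arc g2" "pathstart g2 = q" "pathfinish g2 = p" "path_image g2 = c2"
    using arc_between_sym[OF c2] \<open>p \<noteq> q\<close> unfolding arc_between_def by blast
  obtain g3 where g3: "arc g3" "pathstart g3 = p" "pathfinish g3 = q" "path_image g3 = c3"
    using c3 \<open>p \<noteq> q\<close> unfolding arc_between_def by blast
  have sp: "simple_path (g1 +++ g2)"
    using g1 g2 c12 by (intro simple_path_join_loop) auto
  have img: "path_image (g1 +++ g2) = c1 \<union> c2" using g1 g2 by (simp add: path_image_join)
  have loop: "pathfinish (g1 +++ g2) = pathstart (g1 +++ g2)" using g1 g2 by simp
  obtain A B where AB: "A \<noteq> {}" "open A" "connected A" "B \<noteq> {}" "open B" "connected B"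
     "A \<inter> B = {}" "A \<union> B = - (c1 \<union> c2)" "frontier A = c1 \<union> c2" "frontier B = c1 \<union> c2"
    by (rule Jordan_curve[OF sp loop]) (unfold img, rule that)
  have con: "connected (c3 - {p,q})"
    using connected_simple_path_endless[OF arc_imp_simple_path[OF g3(1)]] g3 by simp
  have sub: "c3 - {p,q} \<subseteq> A \<union> B" using AB(8) c13 c23 by blast
  have "A \<inter> (c3 - {p,q}) = {} \<or> B \<inter> (c3 - {p,q}) = {}"
    by (rule connectedD[OF con AB(2,5)]) (use AB(7) sub in blast)+
  then show ?thesis
  proof
    assume "A \<inter> (c3 - {p,q}) = {}"
    then show ?thesis using AB sub by (intro that[of B A]) auto
  next
    assume "B \<inter> (c3 - {p,q}) = {}"
    then show ?thesis using AB sub by (intro that[of A B]) auto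
  qed
qed

text \<open>
  Each two of the three arcs form a closed curve, and the side of it that avoids the third arc
  is a face whose boundary misses the inside of the third arc.  A set \<open>W\<close> that reaches all three
  arcs lies in none of these faces \<open>J1\<close>, \<open>J2\<close>, \<open>J3\<close>.  Then neither of the closed curves
  \<open>c1 \<union> c2\<close> and \<open>c1 \<union> c3\<close> separates \<open>W\<close> from \<open>J1\<close>, and since
  the two curves share a connected set, Janiszewski's theorem says that their union does not either.
  But \<open>J1\<close> is a whole face.
\<close>

lemma theta_no_fourth_face:
  assumes c1: "arc_between p q c1" and c2: "arc_between p q c2" and c3: "arc_between p q c3"
    and pq: "p \<noteq> q" and c12: "c1 \<inter> c2 = {p,q}" and c13: "c1 \<inter> c3 = {p,q}" and c23: "c2 \<inter> c3 = {p,q}"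
    and W: "connected W" "W \<inter> (c1 \<union> c2 \<union> c3) = {}"
    and cl: "closure W \<inter> (c1 - {p,q}) \<noteq> {}" "closure W \<inter> (c2 - {p,q}) \<noteq> {}" "closure W \<inter> (c3 - {p,q}) \<noteq> {}"
  shows False
proof -
  obtain I3 J3 where 3: "- (c1 \<union> c2) = I3 \<union> J3" "I3 \<inter> J3 = {}" "open I3" "open J3" "connected I3"
    "connected J3" "J3 \<noteq> {}" "frontier J3 = c1 \<union> c2" "c3 - {p,q} \<subseteq> I3"
    using theta_sides[OF c1 c2 c3 pq c12 c13 c23] .
  obtain I2 J2 where 2: "- (c1 \<union> c3) = I2 \<union> J2" "I2 \<inter> J2 = {}" "open I2" "open J2" "connected I2"
    "connected J2" "J2 \<noteq> {}" "frontier J2 = c1 \<union> c3" "c2 - {p,q} \<subseteq> I2"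
    using theta_sides[OF c1 c3 c2 pq c13 c12] c23 by (metis Int_commute)
  obtain I1 J1 where 1: "- (c2 \<union> c3) = I1 \<union> J1" "I1 \<inter> J1 = {}" "open I1" "open J1" "connected I1"
    "connected J1" "J1 \<noteq> {}" "frontier J1 = c2 \<union> c3" "c1 - {p,q} \<subseteq> I1"
    using theta_sides[OF c2 c3 c1 pq c23] c12 c13 by (metis Int_commute)
  have avoid: "W \<inter> J = {}" if "- K = I \<union> J" "I \<inter> J = {}" "open I" "open J" "frontier J = K"
      "c - {p,q} \<subseteq> I" "closure W \<inter> (c - {p,q}) \<noteq> {}" "K \<subseteq> c1 \<union> c2 \<union> c3" for I J K c
  proof (rule ccontr)
    assume "W \<inter> J \<noteq> {}"
    moreover have "W \<subseteq> I \<union> J" using that(1,8) W(2) by blast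
    ultimately have "W \<inter> I = {}"
      using connectedD[OF W(1) that(3,4)] that(2) by blast
    then have "closure W \<inter> I = {}" using that(3) by (metis inf_commute open_Int_closure_eq_empty)
    then show False using that(6,7) by blast
  qed
  have W3: "W \<inter> J3 = {}" by (rule avoid[OF 3(1-4) 3(8,9) cl(3)]) blast
  have W2: "W \<inter> J2 = {}" by (rule avoid[OF 2(1-4) 2(8,9) cl(2)]) blast
  have W1: "W \<inter> J1 = {}" by (rule avoid[OF 1(1-4) 1(8,9) cl(1)]) blast
  have ne: "c - {p,q} \<noteq> {}" if "closure W \<inter> (c - {p,q}) \<noteq> {}" for c using that by blast
  \<comment> \<open>Two of these faces that met would be equal, but their frontiers are different closed curves.\<close>
  have disj: "J \<inter> J' = {}"
    if J: "- K = I \<union> J" "I \<inter> J = {}" "open I" "open J" "connected J" "frontier J = K" "c - {p,q} \<subseteq> I"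
    and J': "- K' = I' \<union> J'" "I' \<inter> J' = {}" "open I'" "open J'" "connected J'" "frontier J' = K'" "c' - {p,q} \<subseteq> I'"
    and K: "K' \<subseteq> K \<union> c" "K \<subseteq> K' \<union> c'" "K \<noteq> K'" "p \<in> K" "q \<in> K" "p \<in> K'" "q \<in> K'" for I J K c I' J' K' c'
  proof (rule ccontr)
    assume ne: "J \<inter> J' \<noteq> {}"
    have "J \<inter> K' = {}" using J K by blast
    then have "J \<subseteq> I' \<union> J'" using J'(1) by blast
    then have "J \<subseteq> J'" using connectedD[OF J(5) J'(3,4)] ne J'(2) by blast
    moreover have "J' \<inter> K = {}" using J' K by blast
    then have "J' \<subseteq> I \<union> J" using J(1) by blast
    then have "J' \<subseteq> J" using connectedD[OF J'(5) J(3,4)] ne J(2) by blast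
    ultimately show False using J(6) J'(6) K(3) by simp
  qed
  have pqs: "p \<in> c1" "q \<in> c1" "p \<in> c2" "q \<in> c2" "p \<in> c3" "q \<in> c3"
    using c12 c13 by blast+
  have 12: "J1 \<inter> J2 = {}"
    by (rule disj[OF 1(1-4) 1(6,8,9) 2(1-4) 2(6,8,9)]) (use pqs ne[OF cl(2)] c12 c23 in blast)+
  have 13: "J1 \<inter> J3 = {}"
    by (rule disj[OF 1(1-4) 1(6,8,9) 3(1-4) 3(6,8,9)]) (use pqs ne[OF cl(3)] c13 c23 in blast)+
  obtain w where w: "w \<in> W" using cl(1) by fastforce
  obtain x where x: "x \<in> J1" using 1(7) by blast
  have xn: "x \<notin> c1 \<union> c2 \<union> c3" using x 1(1,2,9) pqs by blast
  have "w \<in> I3" "w \<in> I2" using w W(2) W3 W2 2(1) 3(1) by blast+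
  moreover have "x \<in> I3" "x \<in> I2" using x xn 12 13 2(1) 3(1) by blast+
  ultimately have "connected_component (- (c1 \<union> c2)) w x" "connected_component (- (c1 \<union> c3)) w x"
    unfolding connected_component_def using 2(1,5) 3(1,5) by blast+
  moreover have "(c1 \<union> c2) \<inter> (c1 \<union> c3) = c1 \<union> (c2 \<inter> c3)" by blast
  then have "(c1 \<union> c2) \<inter> (c1 \<union> c3) = c1" using c23 pqs by auto
  ultimately have "connected_component (- ((c1 \<union> c2) \<union> (c1 \<union> c3))) w x"
    using Janiszewski[of "c1 \<union> c2" "c1 \<union> c3" w x] arc_between_compact[OF c1]
      arc_between_compact[OF c2] arc_between_compact[OF c3]
      path_connected_imp_connected[OF arc_between_path_connected[OF c1]]
    by (simp only: compact_Un compact_imp_closed)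
  then obtain Y where Y: "connected Y" "Y \<subseteq> - ((c1 \<union> c2) \<union> (c1 \<union> c3))" "w \<in> Y" "x \<in> Y"
    unfolding connected_component_def by blast
  have "Y \<subseteq> I1 \<union> J1" using Y(2) 1(1) by blast
  then have "I1 \<inter> Y = {} \<or> J1 \<inter> Y = {}" using connectedD[OF Y(1) 1(3,4)] 1(2) by blast
  moreover have "w \<in> I1" using w W(2) W1 1(1) by blast
  ultimately show False using x Y by blast
qed


lemma arc_between_minus_end:
  assumes "arc_between a z L" "a \<noteq> z"
  shows "connected (L - {z})" "z \<in> closure (L - {z})" "a \<in> L - {z}"
proof -
  obtain g where g: "arc g" "pathstart g = a" "pathfinish g = z" "path_image g = L"
    using assms unfolding arc_between_def by blast
  have cont: "continuous_on {0..1} g" and inj: "inj_on g {0..1}"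
    using g(1) by (simp_all add: arc_def path_def)
  have eq: "L - {z} = g ` {0..<1}"
  proof -
    have "{0..<1} = {0..1} - {1::real}" by auto
    then have "g ` {0..<1} = g ` {0..1} - g ` {1}" 
      using inj_on_image_set_diff[OF inj, of "{0..1}" "{1}"] by simp
    then show ?thesis using g by (simp add: path_image_def pathfinish_def)
  qed
  show "connected (L - {z})" unfolding eq
    by (intro connected_continuous_image continuous_on_subset[OF cont]) auto
  have "g ` closure {0..<1} \<subseteq> closure (g ` {0..<1})"
    by (intro image_closure_subset continuous_on_subset[OF cont]) (auto intro: closure_subset[THEN subsetD])
  then show "z \<in> closure (L - {z})" using g(3) by (auto simp: eq pathfinish_def)
  show "a \<in> L - {z}" using arc_between_ends[OF assms(1)] assms(2) by blast
qed

text \<open>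
  Trimming an arc at both ends makes it meet each of the two sets in exactly one point.
\<close>

lemma arc_between_disjoint_closed_sets:
  assumes "path_connected S" "closed C" "closed D" "S \<inter> C \<noteq> {}" "S \<inter> D \<noteq> {}"
  obtains x y K where "arc_between x y K" "K \<subseteq> S" "K \<inter> C = {x}" "K \<inter> D = {y}"
proof -
  obtain a b where ab: "a \<in> S" "a \<in> C" "b \<in> S" "b \<in> D" using assms(4,5) by blast
  obtain K0 where K0: "arc_between a b K0" "K0 \<subseteq> S" using arc_between_exists[OF assms(1)] ab by metis
  obtain y K1 where K1: "arc_between a y K1" "K1 \<subseteq> K0" "K1 \<inter> D = {y}"
    using arc_between_first_hit[OF K0(1) assms(3) ab(4)] .
  obtain x K where K: "arc_between y x K" "K \<subseteq> K1" "K \<inter> C = {x}"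
    using arc_between_first_hit[OF arc_between_sym[OF K1(1)] assms(2) ab(2)] .
  show ?thesis
  proof (rule that)
    show "arc_between x y K" by (rule arc_between_sym[OF K(1)])
    show "K \<inter> D = {y}" using K(2) K1(3) arc_between_ends[OF K(1)] by blast
  qed (use K K1 K0 in auto)
qed

text \<open>
  The topological source of all bounds.  The sets \<open>A i\<close> and \<open>B j\<close> are the vertices of
  $K_{3,3}$ and \<open>M i j\<close> are its edges.  Tripods inside \<open>A 0\<close> and \<open>A 1\<close>, joined by arcs through
  \<open>B 0\<close>, \<open>B 1\<close>, \<open>B 2\<close>, form a theta curve.  From a point of \<open>A 2\<close> one reaches each of its three
  arcs without meeting the others, so \<open>A 2\<close> would lie in a fourth face.
\<close>

theorem no_planar_K33_model:
  fixes A B :: "nat \<Rightarrow> complex set" and M :: "nat \<Rightarrow> nat \<Rightarrow> complex set"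
  assumes A: "\<And>i. i < 3 \<Longrightarrow> compact (A i) \<and> path_connected (A i) \<and> A i \<noteq> {}"
    and B: "\<And>j. j < 3 \<Longrightarrow> compact (B j) \<and> path_connected (B j)"
    and M: "\<And>i j. i < 3 \<Longrightarrow> j < 3 \<Longrightarrow> compact (M i j) \<and> path_connected (M i j)"
    and AA: "\<And>i k. i < 3 \<Longrightarrow> k < 3 \<Longrightarrow> i \<noteq> k \<Longrightarrow> A i \<inter> A k = {}"
    and BB: "\<And>j l. j < 3 \<Longrightarrow> l < 3 \<Longrightarrow> j \<noteq> l \<Longrightarrow> B j \<inter> B l = {}"
    and AB: "\<And>i j. i < 3 \<Longrightarrow> j < 3 \<Longrightarrow> A i \<inter> B j = {}"
    and MA: "\<And>i j k. i < 3 \<Longrightarrow> j < 3 \<Longrightarrow> k < 3 \<Longrightarrow> M i j \<inter> A k \<noteq> {} \<longleftrightarrow> k = i"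
    and MB: "\<And>i j l. i < 3 \<Longrightarrow> j < 3 \<Longrightarrow> l < 3 \<Longrightarrow> M i j \<inter> B l \<noteq> {} \<longleftrightarrow> l = j"
    and MM: "\<And>i j k l. i < 3 \<Longrightarrow> j < 3 \<Longrightarrow> k < 3 \<Longrightarrow> l < 3 \<Longrightarrow> (i,j) \<noteq> (k,l) \<Longrightarrow> M i j \<inter> M k l = {}"
  shows False
proof -
  \<comment> \<open>\<open>S j\<close> contains the middle part of the \<open>j\<close>-th arc of the theta curve.\<close>
  define S where "S j = M 0 j \<union> B j \<union> M 1 j" for j
  have clA: "closed (A i)" if "i < 3" for i using A that by (simp add: compact_imp_closed)
  have "\<exists>x y K. arc_between x y K \<and> K \<subseteq> S j \<and> K \<inter> A 0 = {x} \<and> K \<inter> A 1 = {y}" if j: "j < 3" for j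
  proof -
    have "path_connected (S j)" unfolding S_def
      using M[of 0 j] M[of 1 j] B[of j] MB[of 0 j j] MB[of 1 j j] j
      by (intro path_connected_Un) auto
    moreover have "S j \<inter> A 0 \<noteq> {}" "S j \<inter> A 1 \<noteq> {}"
      using MA[of 0 j 0] MA[of 1 j 1] j by (auto simp: S_def)
    ultimately show ?thesis
      using arc_between_disjoint_closed_sets[of "S j" "A 0" "A 1"] clA[of 0] clA[of 1] by (metis one_less_numeral_iff semiring_norm(77) zero_less_numeral)
  qed
  then obtain x y N where N: "\<And>j. j < 3 \<Longrightarrow> arc_between (x j) (y j) (N j) \<and> N j \<subseteq> S j
      \<and> N j \<inter> A 0 = {x j} \<and> N j \<inter> A 1 = {y j}"
    by metis
  have SS: "S j \<inter> S k = {}" if "j < 3" "k < 3" "j \<noteq> k" for j k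
  proof -
    have "M i j \<inter> M i' k = {}" "M i j \<inter> B k = {}" "M i k \<inter> B j = {}" if "i < 3" "i' < 3" for i i'
      using MM[of i j i' k] MB[of i j k] MB[of i k j] \<open>j < 3\<close> \<open>k < 3\<close> \<open>j \<noteq> k\<close> that by auto
    from this[of 0 0] this[of 0 1] this[of 1 0] this[of 1 1] BB[of j k] that show ?thesis
      unfolding S_def by auto
  qed
  \<comment> \<open>\<open>M 0 j\<close> and \<open>M 1 j\<close> are disjoint closed sets, so an arc from one to the other passes through \<open>B j\<close>.\<close>
  have NB: "N j \<inter> B j \<noteq> {}" if j: "j < 3" for j
  proof
    assume e: "N j \<inter> B j = {}"
    have con: "connected (N j)"
      using N[OF j] arc_between_path_connected path_connected_imp_connected by blast
    have sub: "N j \<subseteq> M 0 j \<union> M 1 j" using N[OF j] e unfolding S_def by blast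
    have "closed (M 0 j)" "closed (M 1 j)" using M j by (simp_all add: compact_imp_closed)
    moreover have "M 0 j \<inter> M 1 j = {}" using MM[of 0 j 1 j] j by simp
    ultimately have "M 0 j \<inter> N j = {} \<or> M 1 j \<inter> N j = {}"
      using con sub unfolding connected_closed by blast
    moreover have "x j \<in> N j" "x j \<in> A 0" "y j \<in> N j" "y j \<in> A 1" using N[OF j] by blast+
    moreover have "M 0 j \<inter> A 1 = {}" "M 1 j \<inter> A 0 = {}" using MA[of 0 j 1] MA[of 1 j 0] j by auto
    ultimately show False using sub by blast
  qed
  have xA: "x j \<in> A 0" "y j \<in> A 1" if "j < 3" for j using N[OF that] by blast+
  obtain p X0 X1 X2 where X': "arc_between p (x 0) X0" "arc_between p (x 1) X1" "arc_between p (x 2) X2"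
    "X0 \<subseteq> A 0" "X1 \<subseteq> A 0" "X2 \<subseteq> A 0" "X0 \<inter> X1 = {p}" "X0 \<inter> X2 = {p}" "X1 \<inter> X2 = {p}"
    by (rule tripod_exists[of "A 0" "x 0" "x 1" "x 2"]) (use A[of 0] xA in auto)
  obtain q Y0 Y1 Y2 where Y': "arc_between q (y 0) Y0" "arc_between q (y 1) Y1" "arc_between q (y 2) Y2"
    "Y0 \<subseteq> A 1" "Y1 \<subseteq> A 1" "Y2 \<subseteq> A 1" "Y0 \<inter> Y1 = {q}" "Y0 \<inter> Y2 = {q}" "Y1 \<inter> Y2 = {q}"
    by (rule tripod_exists[of "A 1" "y 0" "y 1" "y 2"]) (use A[of 1] xA in auto)
  define X where "X j = (if j = 0 then X0 else if j = 1 then X1 else X2)" for j :: nat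
  define Y where "Y j = (if j = 0 then Y0 else if j = 1 then Y1 else Y2)" for j :: nat
  have j3: "j = 0 \<or> j = 1 \<or> j = 2" if "j < 3" for j :: nat using that by auto
  have X: "arc_between p (x j) (X j)" "X j \<subseteq> A 0" if "j < 3" for j
    using j3[OF that] X' by (auto simp: X_def)
  have Y: "arc_between q (y j) (Y j)" "Y j \<subseteq> A 1" if "j < 3" for j
    using j3[OF that] Y' by (auto simp: Y_def)
  have XX: "X j \<inter> X k = {p}" and YY: "Y j \<inter> Y k = {q}" if "j < 3" "k < 3" "j \<noteq> k" for j k
    using j3[OF that(1)] j3[OF that(2)] that(3) X' Y' by (auto simp: X_def Y_def Int_commute)
  have A01: "A 0 \<inter> A 1 = {}" using AA[of 0 1] by simp
  define c where "c j = X j \<union> N j \<union> Y j" for j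
  have c: "arc_between p q (c j)" if "j < 3" for j
    unfolding c_def
  proof (rule arc_between_join[OF arc_between_join])
    show "arc_between p (x j) (X j)" "arc_between (x j) (y j) (N j)" "arc_between (y j) q (Y j)"
      using X Y N that by (auto intro: arc_between_sym)
    show "X j \<inter> N j = {x j}"
      using X[OF that] N[OF that] arc_between_ends[OF X(1)[OF that]] by blast
    show "(X j \<union> N j) \<inter> Y j = {y j}"
      using X[OF that] Y[OF that] N[OF that] arc_between_ends[OF Y(1)[OF that]] A01 by blast
  qed
  have cc: "c j \<inter> c k = {p,q}" if jk: "j < 3" "k < 3" "j \<noteq> k" for j k
  proof -
    have 1: "X j \<inter> N k \<subseteq> {p}" if "j < 3" "k < 3" "j \<noteq> k" for j k
    proof -
      have "X j \<inter> N k \<subseteq> {x k}" using N[OF that(2)] X(2)[OF that(1)] by blast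
      then have "X j \<inter> N k \<subseteq> X j \<inter> X k" using arc_between_ends[OF X(1)[OF that(2)]] by blast
      then show ?thesis unfolding XX[OF that] .
    qed
    have 2: "Y j \<inter> N k \<subseteq> {q}" if "j < 3" "k < 3" "j \<noteq> k" for j k
    proof -
      have "Y j \<inter> N k \<subseteq> {y k}" using N[OF that(2)] Y(2)[OF that(1)] by blast
      then have "Y j \<inter> N k \<subseteq> Y j \<inter> Y k" using arc_between_ends[OF Y(1)[OF that(2)]] by blast
      then show ?thesis unfolding YY[OF that] .
    qed
    have 3: "N j \<inter> N k = {}" using N[OF jk(1)] N[OF jk(2)] SS[OF jk] by blast
    have 4: "X j \<inter> Y k = {}" "Y j \<inter> X k = {}"
      using X(2)[OF jk(1)] Y(2)[OF jk(2)] X(2)[OF jk(2)] Y(2)[OF jk(1)] A01 by blast+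
    have "c j \<inter> c k = X j \<inter> X k \<union> X j \<inter> N k \<union> X j \<inter> Y k \<union> (N j \<inter> X k \<union> N j \<inter> N k \<union> N j \<inter> Y k)
        \<union> (Y j \<inter> X k \<union> Y j \<inter> N k \<union> Y j \<inter> Y k)"
      unfolding c_def by blast
    then show ?thesis
      using 1[OF jk] 1[OF jk(2,1) jk(3)[symmetric]] 2[OF jk] 2[OF jk(2,1) jk(3)[symmetric]] 3 4
        XX[OF jk] YY[OF jk] by (auto simp: Int_commute)
  qed
  have pq: "p \<noteq> q" using arc_between_ends[OF X'(1)] arc_between_ends[OF Y'(1)] X'(4) Y'(4) A01 by blast
  have pA: "p \<in> A 0" "q \<in> A 1" using arc_between_ends[OF X'(1)] arc_between_ends[OF Y'(1)] X'(4) Y'(4) by auto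
  \<comment> \<open>\<open>D j\<close> leads from \<open>A 2\<close> to the \<open>j\<close>-th arc of the theta curve and avoids the other two.\<close>
  define D where "D j = A 2 \<union> M 2 j \<union> B j" for j
  have D: "path_connected (D j)" if "j < 3" for j
    unfolding D_def using A[of 2] B[OF that] M[of 2 j] MA[of 2 j 2] MB[of 2 j j] that
    by (intro path_connected_Un) (auto simp: Int_commute)
  have DA: "D j \<inter> A 0 = {}" "D j \<inter> A 1 = {}" if "j < 3" for j
    unfolding D_def using AA[of 2 0] AA[of 2 1] AB[of 0 j] AB[of 1 j] MA[of 2 j 0] MA[of 2 j 1] that by auto
  have DS: "D j \<inter> S k = {}" if "j < 3" "k < 3" "j \<noteq> k" for j k
    unfolding D_def S_def
    using MA[of 0 k 2] MA[of 1 k 2] AB[of 2 k] MM[of 2 j 0 k] MM[of 2 j 1 k] MB[of 2 j k]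
      MB[of 0 k j] MB[of 1 k j] BB[of j k] that by auto
  have Dc: "D j \<inter> c k = {}" if "j < 3" "k < 3" "j \<noteq> k" for j k
  proof -
    have "c k \<subseteq> A 0 \<union> S k \<union> A 1" using X(2)[OF that(2)] Y(2)[OF that(2)] N[OF that(2)] unfolding c_def by auto
    then show ?thesis using DS[OF that] DA[OF that(1)] by blast
  qed
  obtain a where a: "a \<in> A 2" using A[of 2] by auto
  have ac: "a \<notin> c j" if "j < 3" for j
  proof -
    obtain k where k: "k < 3" "k \<noteq> j" using that by (cases "j = 0") (auto intro: that[of 1] that[of 0])
    then show ?thesis using Dc[of k j] a that by (auto simp: D_def)
  qed
  have "\<exists>L z. arc_between a z L \<and> L \<subseteq> D j \<and> L \<inter> c j = {z}" if j: "j < 3" for j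
  proof -
    obtain b where b: "b \<in> N j" "b \<in> B j" using NB[OF j] by blast
    obtain L0 where L0: "arc_between a b L0" "L0 \<subseteq> D j"
      using arc_between_exists[OF D[OF j], of a b] a b by (auto simp: D_def)
    have "closed (c j)" using arc_between_compact[OF c[OF j]] by (rule compact_imp_closed)
    moreover have "b \<in> c j" using b by (simp add: c_def)
    ultimately obtain z L where "arc_between a z L" "L \<subseteq> L0" "L \<inter> c j = {z}"
      using arc_between_first_hit[OF L0(1)] by metis
    then show ?thesis using L0 by blast
  qed
  then obtain L z where L: "\<And>j. j < 3 \<Longrightarrow> arc_between a (z j) (L j) \<and> L j \<subseteq> D j \<and> L j \<inter> c j = {z j}"
    by metis
  have za: "a \<noteq> z j" if "j < 3" for j using ac L that by blast
  define W where "W = (\<Union>j\<in>{..<3}. L j - {z j})"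
  have "connected (L j - {z j})" "a \<in> L j - {z j}" if "j < 3" for j
    using arc_between_minus_end(1,3)[OF _ za[OF that]] L[OF that] by blast+
  then have "connected W" unfolding W_def by (intro connected_Union) blast+
  moreover have Wc: "W \<inter> c k = {}" if "k < 3" for k
  proof -
    have "(L j - {z j}) \<inter> c k = {}" if "j < 3" for j
      using L[OF that] Dc[OF that \<open>k < 3\<close>] by (cases "j = k") blast+
    then show ?thesis unfolding W_def by blast
  qed
  have "W \<inter> (c 0 \<union> c 1 \<union> c 2) = {}" using Wc[of 0] Wc[of 1] Wc[of 2] by (simp add: Int_Un_distrib)
  moreover have clW: "closure W \<inter> (c j - {p,q}) \<noteq> {}" if j: "j < 3" for j
  proof -
    have "z j \<in> closure W"
      using arc_between_minus_end(2)[OF _ za[OF j]] L[OF j] closure_mono[of "L j - {z j}" W] j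
      by (auto simp: W_def)
    moreover have "z j \<in> c j" "z j \<in> D j" using L[OF j] by blast+
    ultimately show ?thesis using DA[OF j] pA by blast
  qed
  ultimately show False
    using theta_no_fourth_face[OF c[of 0] c[of 1] c[of 2] pq cc[of 0 1] cc[of 0 2] cc[of 1 2] _ _
        clW[of 0] clW[of 1] clW[of 2]] by simp
qed

section \<open>Complete minors of dense graphs\<close>

text \<open>
  In this part, \<open>\<B>\<close> is a family of disjoint vertex sets, to be thought of as the vertices of a
  graph that arises by contraction; \<open>R\<close> is adjacency in the underlying graph.
\<close>

definition touches :: "('a \<Rightarrow> 'a \<Rightarrow> bool) \<Rightarrow> 'a set \<Rightarrow> 'a set \<Rightarrow> bool" where
  "touches R A B \<longleftrightarrow> (\<exists>u\<in>A. \<exists>v\<in>B. R u v)"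

definition nbrs :: "('a \<Rightarrow> 'a \<Rightarrow> bool) \<Rightarrow> 'a set set \<Rightarrow> 'a set \<Rightarrow> 'a set set" where
  "nbrs R \<B> A = {B \<in> \<B>. B \<noteq> A \<and> touches R A B}"

definition adjacent_pairs :: "('a \<Rightarrow> 'a \<Rightarrow> bool) \<Rightarrow> 'a set set \<Rightarrow> ('a set \<times> 'a set) set" where
  "adjacent_pairs R \<B> = (SIGMA A:\<B>. nbrs R \<B> A)"

definition branch_family :: "('a set \<Rightarrow> bool) \<Rightarrow> 'a set set \<Rightarrow> bool" where
  "branch_family conn \<B> \<longleftrightarrow> finite \<B> \<and> (\<forall>B\<in>\<B>. conn B \<and> B \<noteq> {}) \<and> pairwise disjnt \<B>"

lemma touches_mono: "touches R A B \<Longrightarrow> A \<subseteq> A' \<Longrightarrow> B \<subseteq> B' \<Longrightarrow> touches R A' B'"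
  unfolding touches_def by blast

text \<open>
  Contracting the edge between \<open>A\<close> and \<open>B\<close> loses that edge and one of the two edges to each common
  neighbour.  The factor 2 comes from counting ordered pairs.
\<close>

lemma adjacent_pairs_contract:
  assumes fam: "branch_family conn \<B>" and sym: "\<And>x y. R x y \<Longrightarrow> R y x"
    and AB: "A \<in> \<B>" "B \<in> \<B>" "A \<noteq> B"
  defines "\<B>' \<equiv> insert (A \<union> B) (\<B> - {A, B})"
  shows "card (adjacent_pairs R \<B>) \<le> card (adjacent_pairs R \<B>') + 2 * card (nbrs R \<B> A \<inter> nbrs R \<B> B) + 2"
proof -
  have fin: "finite \<B>" and disj: "\<And>X Y. X \<in> \<B> \<Longrightarrow> Y \<in> \<B> \<Longrightarrow> X \<noteq> Y \<Longrightarrow> X \<inter> Y = {}"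
    and ne: "\<And>X. X \<in> \<B> \<Longrightarrow> X \<noteq> {}"
    using fam by (auto simp: branch_family_def pairwise_def disjnt_def)
  define N where "N = nbrs R \<B> A \<inter> nbrs R \<B> B"
  define f where "f X = (if X = A \<or> X = B then A \<union> B else X)" for X
  \<comment> \<open>\<open>L\<close> collects the ordered pairs lost by contracting: outside \<open>L\<close> the map \<open>f\<close> on pairs is injective.\<close>
  define L where "L = {(A,B),(B,A)} \<union> (\<lambda>X. (B,X)) ` N \<union> (\<lambda>X. (X,B)) ` N"
  have finN: "finite N" unfolding N_def nbrs_def using fin by simp
  have "card L \<le> card {(A,B),(B,A)} + card ((\<lambda>X. (B,X)) ` N) + card ((\<lambda>X. (X,B)) ` N)"
    unfolding L_def by (rule order_trans[OF card_Un_le add_right_mono[OF card_Un_le]])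
  moreover have "card {(A,B),(B,A)} = 2" using AB(3) by simp
  ultimately have cL: "card L \<le> 2 * card N + 2"
    using card_image_le[OF finN, of "\<lambda>X. (B,X)"] card_image_le[OF finN, of "\<lambda>X. (X,B)"] by linarith
  have AnB: "A \<union> B \<notin> \<B>" using disj[OF AB] disj[of A "A \<union> B"] disj[of B "A \<union> B"] ne AB by blast
  have tsym: "touches R X Y \<Longrightarrow> touches R Y X" for X Y unfolding touches_def using sym by blast
  have "inj_on (map_prod f f) (adjacent_pairs R \<B> - L)"
  proof (rule inj_onI, clarify)
    fix X Y X' Y'
    assume 1: "(X,Y) \<in> adjacent_pairs R \<B>" "(X,Y) \<notin> L" "(X',Y') \<in> adjacent_pairs R \<B>" "(X',Y') \<notin> L"
      "map_prod f f (X,Y) = map_prod f f (X',Y')"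
    have mem: "X \<in> \<B>" "Y \<in> \<B>" "X' \<in> \<B>" "Y' \<in> \<B>" "X \<noteq> Y" "X' \<noteq> Y'" "touches R X Y" "touches R X' Y'"
      using 1 by (auto simp: adjacent_pairs_def nbrs_def)
    have eqs: "f X = f X'" "f Y = f Y'" using 1(5) by simp_all
    have e1: "X = X' \<or> {X,X'} = {A,B}" using eqs(1) mem AnB unfolding f_def by (auto split: if_splits)
    have e2: "Y = Y' \<or> {Y,Y'} = {A,B}" using eqs(2) mem AnB unfolding f_def by (auto split: if_splits)
    have nL: "\<not> (U = A \<and> V = B \<or> U = B \<and> V = A)" if "(U,V) \<notin> L" for U V
      using that by (auto simp: L_def)
    have c1: "X = X'"
    proof (rule ccontr)
      assume "X \<noteq> X'"
      then have X: "X = A \<and> X' = B \<or> X = B \<and> X' = A" using e1 by (auto simp: doubleton_eq_iff)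
      have "Y = Y'"
        using e2 X nL[OF 1(2)] nL[OF 1(4)] mem(5,6) by (auto simp: doubleton_eq_iff)
      then have "Y \<in> N" using X mem unfolding N_def nbrs_def by auto
      then show False using X 1(2,4) \<open>Y = Y'\<close> by (auto simp: L_def)
    qed
    have c2: "Y = Y'"
    proof (rule ccontr)
      assume "Y \<noteq> Y'"
      then have Y: "Y = A \<and> Y' = B \<or> Y = B \<and> Y' = A" using e2 by (auto simp: doubleton_eq_iff)
      then have "X \<in> N" using c1 mem tsym unfolding N_def nbrs_def by auto
      then show False using Y 1(2,4) c1 by (auto simp: L_def)
    qed
    show "X = X' \<and> Y = Y'" using c1 c2 by blast
  qed
  moreover have "map_prod f f ` (adjacent_pairs R \<B> - L) \<subseteq> adjacent_pairs R \<B>'"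
  proof (rule image_subsetI, clarify)
    fix X Y assume 1: "(X,Y) \<in> adjacent_pairs R \<B>" "(X,Y) \<notin> L"
    have mem: "X \<in> \<B>" "Y \<in> \<B>" "X \<noteq> Y" "touches R X Y" using 1 by (auto simp: adjacent_pairs_def nbrs_def)
    have "f X \<in> \<B>'" "f Y \<in> \<B>'" using mem by (auto simp: f_def \<B>'_def)
    moreover have "f X \<noteq> f Y"
      using 1(2) mem AnB by (auto simp: f_def L_def split: if_splits)
    moreover have "touches R (f X) (f Y)"
      by (rule touches_mono[OF mem(4)]) (auto simp: f_def)
    ultimately show "map_prod f f (X,Y) \<in> adjacent_pairs R \<B>'" by (simp add: adjacent_pairs_def nbrs_def)
  qed
  moreover have "finite (adjacent_pairs R \<B>')"
    unfolding adjacent_pairs_def nbrs_def \<B>'_def using fin by auto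
  ultimately have "card (adjacent_pairs R \<B> - L) \<le> card (adjacent_pairs R \<B>')"
    by (rule card_inj_on_le)
  moreover have "card (adjacent_pairs R \<B>) \<le> card (adjacent_pairs R \<B> - L) + card L"
    using diff_card_le_card_Diff[of L "adjacent_pairs R \<B>"] finN by (simp add: L_def)
  ultimately show ?thesis using cL unfolding N_def by linarith
qed

text \<open>
  A weak form of merging members of \<open>\<B>\<close>: containing some member preserves adjacency to other
  sets, and lying inside the union of \<open>\<B>\<close> preserves disjointness from sets outside.
\<close>

definition coarsens :: "'a set set \<Rightarrow> 'a set set \<Rightarrow> bool" where
  "coarsens \<C> \<B> \<longleftrightarrow> (\<forall>C\<in>\<C>. C \<subseteq> \<Union>\<B> \<and> (\<exists>B\<in>\<B>. B \<subseteq> C))"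

text \<open>
  Mader's argument.  If some adjacent pair has few common neighbours, contracting it preserves
  the density, and one inducts on the number of sets.  Otherwise, inside the neighbourhood of any
  set of positive degree all degrees are at least $2^t$, so the neighbourhood contains a complete minor on
  one vertex less, which the set itself completes.  The predicate \<open>conn\<close> can be any notion of
  connectedness that is preserved when two touching sets are merged.
\<close>

theorem complete_minor_of_dense:
  assumes sym: "\<And>x y. R x y \<Longrightarrow> R y x"
    and merge: "\<And>A B. conn A \<Longrightarrow> conn B \<Longrightarrow> A \<inter> B = {} \<Longrightarrow> touches R A B \<Longrightarrow> conn (A \<union> B)"
    and "branch_family conn \<B>" "\<B> \<noteq> {}" "2 ^ t * card \<B> \<le> card (adjacent_pairs R \<B>)"
  shows "\<exists>\<C>. branch_family conn \<C> \<and> card \<C> = t + 2 \<and> coarsens \<C> \<B> \<and> pairwise (touches R) \<C>"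
  using assms(3-5)
proof (induction t arbitrary: \<B>)
  case 0
  then have "adjacent_pairs R \<B> \<noteq> {}" by (auto simp: branch_family_def)
  then obtain A B where AB: "A \<in> \<B>" "B \<in> \<B>" "A \<noteq> B" "touches R A B"
    unfolding adjacent_pairs_def nbrs_def by auto
  then have "touches R B A" using sym unfolding touches_def by blast
  with AB 0(1) show ?case
    by (intro exI[of _ "{A,B}"]) (auto simp: branch_family_def coarsens_def pairwise_def)
next
  case (Suc t)
  show ?case using Suc.prems
  proof (induction "card \<B>" arbitrary: \<B> rule: less_induct)
    case less
    note fam = less.prems(1)
    have fin: "finite \<B>" and disj: "\<And>X Y. X \<in> \<B> \<Longrightarrow> Y \<in> \<B> \<Longrightarrow> X \<noteq> Y \<Longrightarrow> X \<inter> Y = {}"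
      and ne: "\<And>X. X \<in> \<B> \<Longrightarrow> X \<noteq> {}" and conn: "\<And>X. X \<in> \<B> \<Longrightarrow> conn X"
      using fam by (auto simp: branch_family_def pairwise_def disjnt_def)
    show ?case
    proof (cases "\<exists>A\<in>\<B>. \<exists>B\<in>nbrs R \<B> A. card (nbrs R \<B> A \<inter> nbrs R \<B> B) < 2 ^ t")
      case True
      then obtain A B where AB: "A \<in> \<B>" "B \<in> \<B>" "A \<noteq> B" "touches R A B"
        and common: "card (nbrs R \<B> A \<inter> nbrs R \<B> B) < 2 ^ t"
        by (auto simp: nbrs_def)
      define \<B>' where "\<B>' = insert (A \<union> B) (\<B> - {A, B})"
      have AnB: "A \<union> B \<notin> \<B>"
        using disj[OF AB(1-3)] disj[of A "A \<union> B"] disj[of B "A \<union> B"] ne AB by blast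
      have two: "card {A, B} \<le> card \<B>" using fin AB by (intro card_mono) auto
      have "card \<B>' = Suc (card (\<B> - {A, B}))"
        unfolding \<B>'_def using fin AnB by simp
      also have "card (\<B> - {A, B}) = card \<B> - 2"
        using fin AB by (subst card_Diff_subset) auto
      finally have card': "card \<B>' = card \<B> - 1" "0 < card \<B>'" using two AB(3) by auto
      have fam': "branch_family conn \<B>'"
        unfolding branch_family_def
      proof (intro conjI)
        show "finite \<B>'" using fin by (simp add: \<B>'_def)
        show "\<forall>X\<in>\<B>'. conn X \<and> X \<noteq> {}"
          using conn ne merge[OF conn[OF AB(1)] conn[OF AB(2)] disj[OF AB(1-3)] AB(4)] AB(1)
          by (auto simp: \<B>'_def)
        have "(A \<union> B) \<inter> X = {}" if "X \<in> \<B> - {A, B}" for X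
          using disj[of A X] disj[of B X] AB that by blast
        then show "pairwise disjnt \<B>'"
          using disj unfolding \<B>'_def pairwise_insert by (auto simp: pairwise_def disjnt_def)
      qed
      have "card (adjacent_pairs R \<B>) \<le> card (adjacent_pairs R \<B>') + 2 * card (nbrs R \<B> A \<inter> nbrs R \<B> B) + 2"
        unfolding \<B>'_def by (rule adjacent_pairs_contract[OF fam sym AB(1-3)])
      moreover have "2 ^ Suc t * card \<B> = 2 ^ Suc t * card \<B>' + 2 ^ Suc t"
        using card' by (cases "card \<B>") auto
      ultimately have "2 ^ Suc t * card \<B>' \<le> card (adjacent_pairs R \<B>')"
        using less.prems(3) common by simp
      then obtain \<C> where C: "branch_family conn \<C>" "card \<C> = Suc t + 2" "coarsens \<C> \<B>'"
          "pairwise (touches R) \<C>"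
        using less.hyps[OF _ fam'] card' by (metis card_gt_0_iff diff_less less.prems(2) fin zero_less_one)
      have "\<Union>\<B>' \<subseteq> \<Union>\<B>" "\<And>B'. B' \<in> \<B>' \<Longrightarrow> \<exists>B\<in>\<B>. B \<subseteq> B'"
        using AB by (auto simp: \<B>'_def)
      then have "coarsens \<C> \<B>" using C(3) unfolding coarsens_def by (meson order_trans)
      then show ?thesis using C by blast
    next
      case False
      have "adjacent_pairs R \<B> \<noteq> {}" using less.prems fin by (auto simp: card_eq_0_iff)
      then obtain A where A: "A \<in> \<B>" "nbrs R \<B> A \<noteq> {}" unfolding adjacent_pairs_def by auto
      define \<N> where "\<N> = nbrs R \<B> A"
      have sub: "\<N> \<subseteq> \<B>" unfolding \<N>_def nbrs_def by blast
      have finN: "finite \<N>" using finite_subset[OF sub fin] .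
      have famN: "branch_family conn \<N>"
        using fam sub finN pairwise_subset[of disjnt \<B> \<N>] by (auto simp: branch_family_def)
      have deg: "2 ^ t \<le> card (nbrs R \<N> B)" if "B \<in> \<N>" for B
      proof -
        have "nbrs R \<B> A \<inter> nbrs R \<B> B = nbrs R \<N> B" by (auto simp: \<N>_def nbrs_def)
        then show ?thesis using False A(1) that unfolding \<N>_def by (metis not_less)
      qed
      have "2 ^ t * card \<N> = (\<Sum>B\<in>\<N>. 2 ^ t)" by simp
      also have "\<dots> \<le> (\<Sum>B\<in>\<N>. card (nbrs R \<N> B))" by (rule sum_mono) (rule deg)
      also have "\<dots> = card (adjacent_pairs R \<N>)"
        unfolding adjacent_pairs_def using finN by (subst card_SigmaI) (auto simp: nbrs_def)
      finally obtain \<C> where C: "branch_family conn \<C>" "card \<C> = t + 2" "coarsens \<C> \<N>"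
          "pairwise (touches R) \<C>"
        using Suc.IH[OF famN] A(2) unfolding \<N>_def by blast
      have disjA: "A \<inter> C = {}" if "C \<in> \<C>" for C
      proof -
        have "C \<subseteq> \<Union>\<N>" using C(3) that by (simp add: coarsens_def)
        moreover have "A \<inter> B = {}" if "B \<in> \<N>" for B
          using that disj[OF A(1)] by (auto simp: \<N>_def nbrs_def)
        ultimately show ?thesis by blast
      qed
      have neC: "C \<noteq> {}" if "C \<in> \<C>" for C using C(1) that by (auto simp: branch_family_def)
      have AC: "A \<notin> \<C>" using disjA neC by blast
      have touchA: "touches R A C \<and> touches R C A" if "C \<in> \<C>" for C
      proof -
        obtain B where "B \<in> \<N>" "B \<subseteq> C" using C(3) \<open>C \<in> \<C>\<close> by (auto simp: coarsens_def)
        then have "touches R A C" unfolding \<N>_def nbrs_def using touches_mono by blast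
        then show ?thesis using sym unfolding touches_def by blast
      qed
      show ?thesis
      proof (intro exI[of _ "insert A \<C>"] conjI)
        show "branch_family conn (insert A \<C>)"
          using C(1) conn[OF A(1)] ne[OF A(1)] disjA
          by (auto simp: branch_family_def pairwise_insert disjnt_def Int_commute)
        show "card (insert A \<C>) = Suc t + 2" using C(1,2) AC by (simp add: branch_family_def)
        show "coarsens (insert A \<C>) \<B>"
          unfolding coarsens_def ball_simps
        proof (intro conjI ballI)
          fix C assume "C \<in> \<C>"
          then have "C \<subseteq> \<Union>\<N>" "\<exists>B\<in>\<N>. B \<subseteq> C" using C(3) by (simp_all add: coarsens_def)
          then show "C \<subseteq> \<Union>\<B>" "\<exists>B\<in>\<B>. B \<subseteq> C" using sub by blast+
        qed (use A(1) in auto)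
        show "pairwise (touches R) (insert A \<C>)"
          using C(4) touchA by (auto simp: pairwise_insert)
      qed
    qed
  qed
qed

section \<open>Graphs in which only edges with a common end may meet\<close>

text \<open>
  \<open>spans E A F\<close> says that \<open>F\<close> is the edge set of a connected subgraph with vertex set \<open>A\<close>.  The
  edges are recorded because their drawn images, not the vertices, will make up the branch sets.
\<close>

inductive spans :: "'a set set \<Rightarrow> 'a set \<Rightarrow> 'a set set \<Rightarrow> bool" for E where
  single: "spans E {v} {}"
| join: "spans E A F \<Longrightarrow> spans E B F' \<Longrightarrow> u \<in> A \<Longrightarrow> v \<in> B \<Longrightarrow> {u,v} \<in> E
    \<Longrightarrow> spans E (A \<union> B) (insert {u,v} (F \<union> F'))"

text \<open>
  Edges are drawn as connected sets, and two of them meet exactly if they share an end.  Crossings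
  between edges with a common end are therefore permitted.
\<close>

definition independence_drawing :: "'a set set \<Rightarrow> ('a set \<Rightarrow> complex set) \<Rightarrow> bool" where
  "independence_drawing E \<Gamma> \<longleftrightarrow>
     (\<forall>e\<in>E. compact (\<Gamma> e) \<and> path_connected (\<Gamma> e)) \<and>
     (\<forall>e\<in>E. \<forall>f\<in>E. \<Gamma> e \<inter> \<Gamma> f \<noteq> {} \<longleftrightarrow> e \<inter> f \<noteq> {})"

lemma spans_edges:
  "spans E A F \<Longrightarrow> F \<subseteq> E \<and> finite F \<and> (F = {} \<and> (\<exists>v. A = {v}) \<or> F \<noteq> {} \<and> \<Union>F = A)"
  by (induction rule: spans.induct) auto

lemma region_meets_iff:
  assumes "independence_drawing E \<Gamma>" "F \<subseteq> E" "F' \<subseteq> E"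
  shows "\<Union>(\<Gamma> ` F) \<inter> \<Union>(\<Gamma> ` F') \<noteq> {} \<longleftrightarrow> \<Union>F \<inter> \<Union>F' \<noteq> {}"
proof -
  have "\<Union>(\<Gamma> ` F) \<inter> \<Union>(\<Gamma> ` F') \<noteq> {} \<longleftrightarrow> (\<exists>e\<in>F. \<exists>f\<in>F'. \<Gamma> e \<inter> \<Gamma> f \<noteq> {})" by blast
  also have "\<dots> \<longleftrightarrow> (\<exists>e\<in>F. \<exists>f\<in>F'. e \<inter> f \<noteq> {})"
    using assms unfolding independence_drawing_def by (meson subsetD)
  also have "\<dots> \<longleftrightarrow> \<Union>F \<inter> \<Union>F' \<noteq> {}" by blast
  finally show ?thesis .
qed

lemma spans_region:
  assumes dr: "independence_drawing E \<Gamma>" and "spans E A F"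
  shows "compact (\<Union>(\<Gamma> ` F))" "path_connected (\<Union>(\<Gamma> ` F))"
proof -
  have "compact (\<Gamma> e)" if "e \<in> F" for e
    using that dr spans_edges[OF assms(2)] unfolding independence_drawing_def by blast
  then show "compact (\<Union>(\<Gamma> ` F))"
    using spans_edges[OF assms(2)] by (intro compact_UN) auto
  show "path_connected (\<Union>(\<Gamma> ` F))"
    using assms(2)
  proof (induction rule: spans.induct)
    case (single v)
    then show ?case by simp
  next
    case (join A F B F' u v)
    define e where "e = {u,v}"
    have e: "e \<in> E" "path_connected (\<Gamma> e)"
      using join dr by (auto simp: e_def independence_drawing_def)
    have attach: "path_connected (S \<union> \<Union>(\<Gamma> ` D))"
      if "path_connected S" "\<Gamma> e \<subseteq> S" "path_connected (\<Union>(\<Gamma> ` D))" "spans E C D" "w \<in> C" "w \<in> e" for S C D w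
    proof (cases "D = {}")
      case False
      then have "D \<subseteq> E" "w \<in> \<Union>D" using spans_edges[OF that(4)] that(5) by auto
      then have "\<Gamma> e \<inter> \<Union>(\<Gamma> ` D) \<noteq> {}"
        using region_meets_iff[OF dr, of "{e}" D] e(1) that(6) by auto
      then show ?thesis using that by (intro path_connected_Un) auto
    qed (use that in simp)
    have "path_connected (\<Gamma> e \<union> \<Union>(\<Gamma> ` F))"
      by (rule attach[OF e(2) order_refl join.IH(1) join.hyps(1)]) (use join in \<open>auto simp: e_def\<close>)
    then have "path_connected (\<Gamma> e \<union> \<Union>(\<Gamma> ` F) \<union> \<Union>(\<Gamma> ` F'))"
      by (rule attach[OF _ _ join.IH(2) join.hyps(2)]) (use join in \<open>auto simp: e_def\<close>)
    then show ?case by (simp add: e_def Un_assoc image_Un)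
  qed
qed

lemma card_ordered_edges:
  assumes "finite E" "\<And>e. e \<in> E \<Longrightarrow> card e = 2"
  shows "card {(u,v). {u,v} \<in> E} = 2 * card E"
proof -
  have pairs: "card {(u,v). {u,v} = e} = 2 \<and> finite {(u,v). {u,v} = e}" if "e \<in> E" for e
  proof -
    obtain a b where "e = {a,b}" "a \<noteq> b" using assms(2)[OF \<open>e \<in> E\<close>] by (auto simp: card_2_iff)
    then have "{(u,v). {u,v} = e} = {(a,b),(b,a)}" by (auto simp: doubleton_eq_iff)
    then show ?thesis using \<open>a \<noteq> b\<close> by simp
  qed
  have eq: "{(u,v). {u,v} \<in> E} = (\<Union>e\<in>E. {(u,v). {u,v} = e})" by auto
  have "card {(u,v). {u,v} \<in> E} = (\<Sum>e\<in>E. card {(u,v). {u,v} = e})"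
    unfolding eq by (rule card_UN_disjoint) (use assms(1) pairs in auto)
  also have "\<dots> = 2 * card E" using pairs by simp
  finally show ?thesis .
qed

lemma base3_digits_eq: "r < 3 \<Longrightarrow> s < 3 \<Longrightarrow> 3 * n + r = 3 * m + s \<longleftrightarrow> n = m \<and> r = (s :: nat)"
  by presburger

text \<open>
  A graph of larger density has a complete minor on 18 branch sets.  They are merged in threes into
  the six vertices of $K_{3,3}$, so that the nine edges between them can start and end in
  different branch sets.  Being pairwise disjoint, these nine edges are drawn as disjoint sets, although
  adjacent edges are allowed to cross; this contradicts the nonplanarity of $K_{3,3}$.
\<close>

theorem independence_drawing_linear:
  assumes V: "finite V" and E: "\<And>e. e \<in> E \<Longrightarrow> e \<subseteq> V \<and> card e = 2"
    and dr: "independence_drawing E \<Gamma>"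
  shows "card E \<le> 2 ^ 15 * card V"
proof (rule ccontr)
  assume dense: "\<not> card E \<le> 2 ^ 15 * card V"
  have finE: "finite E" using V E finite_subset[of E "Pow V"] by auto
  define R where "R u v \<longleftrightarrow> {u,v} \<in> E" for u v
  define conn where "conn A \<longleftrightarrow> (\<exists>F. spans E A F)" for A
  define \<B> where "\<B> = (\<lambda>v. {v}) ` V"
  have merge: "conn (A \<union> B)" if "conn A" "conn B" "touches R A B" for A B
    using that spans.join unfolding conn_def touches_def R_def by metis
  have "branch_family conn \<B>"
    using V spans.single unfolding branch_family_def \<B>_def conn_def
    by (fastforce simp: pairwise_def)
  moreover have "\<B> \<noteq> {}"
  proof -
    have "E \<noteq> {}" using dense by auto
    then obtain e where "e \<subseteq> V" "card e = 2" using E by blast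
    then show ?thesis by (auto simp: \<B>_def)
  qed
  moreover have "2 ^ 16 * card \<B> \<le> card (adjacent_pairs R \<B>)"
  proof -
    have "(\<lambda>(u,v). ({u},{v})) ` {(u,v). {u,v} \<in> E} \<subseteq> adjacent_pairs R \<B>"
      using E by (fastforce simp: adjacent_pairs_def nbrs_def touches_def R_def \<B>_def)
    moreover have "finite (adjacent_pairs R \<B>)" using V by (auto simp: adjacent_pairs_def nbrs_def \<B>_def)
    ultimately have "card {(u,v). {u,v} \<in> E} \<le> card (adjacent_pairs R \<B>)"
      by (intro card_inj_on_le[of "\<lambda>(u,v). ({u},{v})"]) (auto simp: inj_on_def)
    moreover have "card \<B> = card V" unfolding \<B>_def by (rule card_image) simp
    ultimately show ?thesis using dense card_ordered_edges[of E] finE E by auto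
  qed
  ultimately obtain \<C> where C: "branch_family conn \<C>" "card \<C> = 16 + 2" "pairwise (touches R) \<C>"
    using complete_minor_of_dense[of R conn \<B> 16] merge by (auto simp: R_def insert_commute)
  then obtain Z :: "nat \<Rightarrow> _" where Z: "bij_betw Z {0..<18} \<C>"
    using ex_bij_betw_nat_finite[of \<C>] by (auto simp: branch_family_def)
  have ZC: "Z n \<in> \<C>" if "n < 18" for n using bij_betwE[OF Z] that by auto
  have Zne: "Z n \<noteq> Z m" if "n < 18" "m < 18" "n \<noteq> m" for n m
    using bij_betw_imp_inj_on[OF Z] that by (auto simp: inj_on_def)
  have Zdisj: "Z n \<inter> Z m = {}" if "n < 18" "m < 18" "n \<noteq> m" for n m
    using C(1) ZC[OF that(1)] ZC[OF that(2)] Zne[OF that] by (auto simp: branch_family_def pairwise_def disjnt_def)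
  have Ztouch: "touches R (Z n) (Z m)" if "n < 18" "m < 18" "n \<noteq> m" for n m
    using C(3) ZC[OF that(1)] ZC[OF that(2)] Zne[OF that] by (auto simp: pairwise_def)
  have Zconn: "conn (Z n)" and Z0: "Z n \<noteq> {}" if "n < 18" for n
    using C(1) ZC[OF that] by (auto simp: branch_family_def)
  \<comment> \<open>\<open>G 0\<close> to \<open>G 2\<close> form one side of $K_{3,3}$ and \<open>G 3\<close> to \<open>G 5\<close> the other.  The edge from \<open>G i\<close> to
    \<open>G (3 + j)\<close> uses the \<open>j\<close>-th part of the former and the \<open>i\<close>-th part of the latter.\<close>
  define G where "G n = (\<Union>r<3. Z (3 * n + r))" for n
  have G3: "G n = Z (3*n) \<union> Z (3*n+1) \<union> Z (3*n+2)" for n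
    unfolding G_def by (simp add: eval_nat_numeral lessThan_Suc Un_ac)
  have Gdisj: "G n \<inter> G m = {}" if "n < 6" "m < 6" "n \<noteq> m" for n m
  proof -
    have "Z (3*n+r) \<inter> Z (3*m+s) = {}" if "r < 3" "s < 3" for r s
      using \<open>n < 6\<close> \<open>m < 6\<close> \<open>n \<noteq> m\<close> that by (intro Zdisj) presburger+
    then show ?thesis unfolding G_def by blast
  qed
  have "\<exists>F. spans E (G n) F" if n: "n < 6" for n
  proof -
    have "touches R (Z (3*n)) (Z (3*n+1))" using Ztouch n by simp
    then have "conn (Z (3*n) \<union> Z (3*n+1))" using Zconn n by - (rule merge, auto)
    moreover have "touches R (Z (3*n) \<union> Z (3*n+1)) (Z (3*n+2))"
      by (rule touches_mono[OF Ztouch[of "3*n" "3*n+2"]]) (use n in auto)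
    ultimately have "conn (G n)" unfolding G3 using Zconn n by - (rule merge, auto)
    then show ?thesis by (simp add: conn_def)
  qed
  then obtain F where F: "\<And>n. n < 6 \<Longrightarrow> spans E (G n) (F n)" by metis
  have FG: "\<Union>(F n) = G n \<and> F n \<subseteq> E" if n: "n < 6" for n
  proof -
    have "G n \<noteq> {v}" for v
    proof
      assume eq: "G n = {v}"
      have "Z (3*n) \<subseteq> {v}" "Z (3*n+1) \<subseteq> {v}" using eq unfolding G3 by auto
      then show False using Zdisj[of "3*n" "3*n+1"] Z0[of "3*n"] Z0[of "3*n+1"] n by auto
    qed
    then show ?thesis using spans_edges[OF F[OF n]] by auto
  qed
  have "\<exists>e. e \<in> E \<and> (\<exists>u\<in>Z (3*i+j). \<exists>v\<in>Z (3*(3+j)+i). e = {u,v})" if "i < 3" "j < 3" for i j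
    using Ztouch[of "3*i+j" "3*(3+j)+i"] that unfolding touches_def R_def by auto
  then obtain e where e: "\<And>i j. i < 3 \<Longrightarrow> j < 3 \<Longrightarrow> e i j \<in> E \<and> (\<exists>u\<in>Z (3*i+j). \<exists>v\<in>Z (3*(3+j)+i). e i j = {u,v})"
    by metis
  have eG: "e i j \<inter> G n \<noteq> {} \<longleftrightarrow> n = i \<or> n = 3 + j" if ij: "i < 3" "j < 3" and n: "n < 6" for i j n
  proof -
    obtain u v where uv: "u \<in> Z (3*i+j)" "v \<in> Z (3*(3+j)+i)" "e i j = {u,v}" using e[OF ij] by blast
    then have "u \<in> G i" "v \<in> G (3+j)" using ij unfolding G_def by blast+
    moreover have "u \<notin> G n" if "n \<noteq> i" using \<open>u \<in> G i\<close> Gdisj[of i n] ij n that by auto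
    moreover have "v \<notin> G n" if "n \<noteq> 3 + j" using \<open>v \<in> G (3+j)\<close> Gdisj[of "3+j" n] ij n that by auto
    ultimately show ?thesis using uv(3) by auto
  qed
  have ee: "e i j \<inter> e k l = {}" if ijkl: "i < 3" "j < 3" "k < 3" "l < 3" "(i,j) \<noteq> (k,l)" for i j k l
  proof -
    have "3*i+j \<noteq> 3*k+l" "3*(3+j)+i \<noteq> 3*(3+l)+k"
      using ijkl base3_digits_eq[of j l i k] base3_digits_eq[of i k "3+j" "3+l"] by auto
    moreover have "3*i+j \<noteq> 3*(3+l)+k" "3*(3+j)+i \<noteq> 3*k+l"
      using ijkl base3_digits_eq[of j k i "3+l"] base3_digits_eq[of i l "3+j" k] by auto
    ultimately have "Z (3*i+j) \<inter> Z (3*k+l) = {}" "Z (3*i+j) \<inter> Z (3*(3+l)+k) = {}"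
      "Z (3*(3+j)+i) \<inter> Z (3*k+l) = {}" "Z (3*(3+j)+i) \<inter> Z (3*(3+l)+k) = {}"
      using ijkl(1-4) by (simp_all add: Zdisj)
    moreover obtain u v where "u \<in> Z (3*i+j)" "v \<in> Z (3*(3+j)+i)" "e i j = {u,v}"
      using e[OF ijkl(1,2)] by blast
    moreover obtain u' v' where "u' \<in> Z (3*k+l)" "v' \<in> Z (3*(3+l)+k)" "e k l = {u',v'}"
      using e[OF ijkl(3,4)] by blast
    ultimately show ?thesis by (simp add: disjoint_iff) metis
  qed
  have Ge: "\<Gamma> f \<inter> \<Gamma> f' \<noteq> {} \<longleftrightarrow> f \<inter> f' \<noteq> {}" if "f \<in> E" "f' \<in> E" for f f'
    using dr that by (simp add: independence_drawing_def)
  define P where "P n = \<Union>(\<Gamma> ` F n)" for n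
  have PP: "P n \<inter> P m = {}" if "n < 6" "m < 6" "n \<noteq> m" for n m
    using region_meets_iff[OF dr, of "F n" "F m"] FG[OF that(1)] FG[OF that(2)] Gdisj[OF that]
    unfolding P_def by auto
  have eP: "\<Gamma> (e i j) \<inter> P n \<noteq> {} \<longleftrightarrow> n = i \<or> n = 3 + j" if "i < 3" "j < 3" "n < 6" for i j n
    using region_meets_iff[OF dr, of "{e i j}" "F n"] FG[OF that(3)] e[OF that(1,2)] eG[OF that]
    unfolding P_def by auto
  have P: "compact (P n) \<and> path_connected (P n)" if "n < 6" for n
    using spans_region[OF dr F[OF that]] by (simp add: P_def)
  show False
  proof (rule no_planar_K33_model[of P "\<lambda>j. P (3 + j)" "\<lambda>i j. \<Gamma> (e i j)"])
    fix i :: nat assume i: "i < 3"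
    have "P i \<noteq> {}" using eP[of i 0 i] i by auto
    then show "compact (P i) \<and> path_connected (P i) \<and> P i \<noteq> {}" using P i by simp
  next
    fix i j :: nat assume "i < 3" "j < 3"
    then show "compact (\<Gamma> (e i j)) \<and> path_connected (\<Gamma> (e i j))"
      using e dr by (simp add: independence_drawing_def)
  next
    fix i j k l :: nat assume "i < 3" "j < 3" "k < 3" "l < 3" "(i, j) \<noteq> (k, l)"
    then show "\<Gamma> (e i j) \<inter> \<Gamma> (e k l) = {}" using Ge[of "e i j" "e k l"] ee e by blast
  qed (use P PP eP in auto)
qed

section \<open>Averaging over random samples\<close>

lemma double_count:
  assumes "finite A" "finite B"
  shows "(\<Sum>a\<in>A. card {b\<in>B. Q a b}) = (\<Sum>b\<in>B. card {a\<in>A. Q a b})"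
  using sum.swap_restrict[OF assms, of "\<lambda>_ _. 1::nat" Q] by simp

text \<open>
  A random colouring with $N$ colours gives colour 0 to all of $U$ with probability
  $N^{-|U|}$.
\<close>

lemma card_colourings_zero_on:
  assumes "finite V" "U \<subseteq> V" "N \<ge> 1"
  shows "card {\<phi> \<in> V \<rightarrow>\<^sub>E {..<N}. \<forall>u\<in>U. \<phi> u = 0} * N ^ card U = N ^ card V"
proof -
  have "{\<phi> \<in> V \<rightarrow>\<^sub>E {..<N}. \<forall>u\<in>U. \<phi> u = 0} = Pi\<^sub>E V (\<lambda>v. if v \<in> U then {0} else {..<N})"
  proof (intro set_eqI iffI)
    fix \<phi> assume \<phi>: "\<phi> \<in> Pi\<^sub>E V (\<lambda>v. if v \<in> U then {0} else {..<N})"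
    have "\<phi> v < N" if "v \<in> V" for v
      using PiE_mem[OF \<phi> that] assms(3) by (simp split: if_splits)
    moreover have "\<phi> u = 0" if "u \<in> U" for u
      using PiE_mem[OF \<phi>, of u] assms(2) that by auto
    ultimately show "\<phi> \<in> {\<phi> \<in> V \<rightarrow>\<^sub>E {..<N}. \<forall>u\<in>U. \<phi> u = 0}"
      using \<phi> by (simp add: PiE_iff)
  next
    fix \<phi> assume "\<phi> \<in> {\<phi> \<in> V \<rightarrow>\<^sub>E {..<N}. \<forall>u\<in>U. \<phi> u = 0}"
    then show "\<phi> \<in> Pi\<^sub>E V (\<lambda>v. if v \<in> U then {0} else {..<N})"
      by (simp add: PiE_iff)
  qed
  then have "card {\<phi> \<in> V \<rightarrow>\<^sub>E {..<N}. \<forall>u\<in>U. \<phi> u = 0} = (\<Prod>v\<in>V. if v \<in> U then 1 else N)"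
    using assms(1) by (simp add: card_PiE if_distrib cong: if_cong)
  also have "\<dots> = N ^ card (V - U)"
    using assms(1) by (simp add: prod.If_cases Diff_eq)
  finally show ?thesis
    using assms(1,2) by (simp add: power_add[symmetric] card_Diff_subset finite_subset card_mono)
qed

lemma card_subsets_between:
  assumes "finite S" "A \<subseteq> S" "D \<subseteq> S" "A \<inter> D = {}"
  shows "card {K \<in> Pow S. A \<subseteq> K \<and> K \<inter> D = {}} * 2 ^ card (A \<union> D) = 2 ^ card S"
proof -
  have fin: "finite (A \<union> D)" using assms finite_subset by blast
  have "{K \<in> Pow S. A \<subseteq> K \<and> K \<inter> D = {}} = (\<union>) A ` Pow (S - (A \<union> D))"
  proof (intro set_eqI iffI)
    fix K assume K: "K \<in> {K \<in> Pow S. A \<subseteq> K \<and> K \<inter> D = {}}"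
    then have "K = A \<union> (K - A)" "K - A \<in> Pow (S - (A \<union> D))" by auto
    then show "K \<in> (\<union>) A ` Pow (S - (A \<union> D))" by blast
  qed (use assms in auto)
  moreover have "inj_on ((\<union>) A) (Pow (S - (A \<union> D)))" by (rule inj_onI) blast
  ultimately have "card {K \<in> Pow S. A \<subseteq> K \<and> K \<inter> D = {}} = 2 ^ card (S - (A \<union> D))"
    using assms(1) by (simp add: card_image card_Pow)
  moreover have "card (S - (A \<union> D)) + card (A \<union> D) = card S"
    using assms fin by (simp add: card_Diff_subset card_mono)
  ultimately show ?thesis by (simp add: power_add[symmetric])
qed

text \<open>
  The averaging argument of the crossing lemma.  \<open>X\<close> is the set of crossing pairs of independent
  edges.  Choose each vertex with probability $1/N$, by taking one colour class of a random
  colouring, and delete one edge of each surviving pair of \<open>X\<close>; the rest satisfies the linear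
  bound.  An edge survives with probability $N^{-2}$ and a pair of \<open>X\<close> with probability
  $N^{-4}$, because its two edges have four distinct ends.
\<close>

lemma sampling_bound:
  fixes E :: "'a set set" and X :: "('a set \<times> 'a set) set"
  assumes V: "finite V" and E: "\<And>e. e \<in> E \<Longrightarrow> e \<subseteq> V \<and> card e = 2"
    and X: "X \<subseteq> E \<times> E" "\<And>e f. (e,f) \<in> X \<Longrightarrow> e \<inter> f = {}"
    and lin: "\<And>S E'. S \<subseteq> V \<Longrightarrow> E' \<subseteq> E \<Longrightarrow> (\<And>e. e \<in> E' \<Longrightarrow> e \<subseteq> S)
        \<Longrightarrow> (\<And>e f. e \<in> E' \<Longrightarrow> f \<in> E' \<Longrightarrow> (e,f) \<notin> X) \<Longrightarrow> card E' \<le> C * card S"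
    and N: "N \<ge> 1"
  shows "card E * N ^ 2 \<le> C * card V * N ^ 3 + card X"
proof -
  have finE: "finite E" using V E finite_subset[of E "Pow V"] by auto
  have finX: "finite X" using finite_subset[OF X(1)] finE by simp
  define \<Phi> where "\<Phi> = (V \<rightarrow>\<^sub>E {..<N})"
  have fin\<Phi>: "finite \<Phi>" using V by (simp add: \<Phi>_def finite_PiE)
  define Z where "Z \<phi> U \<longleftrightarrow> (\<forall>u\<in>U. \<phi> u = 0)" for \<phi> :: "'a \<Rightarrow> nat" and U
  have cZ: "card {\<phi> \<in> \<Phi>. Z \<phi> U} * N ^ card U = N ^ card V" if "U \<subseteq> V" for U
    unfolding \<Phi>_def Z_def by (rule card_colourings_zero_on[OF V that N])
  have each: "card {e \<in> E. Z \<phi> e} \<le> C * card {v \<in> V. Z \<phi> {v}} + card {x \<in> X. Z \<phi> (fst x \<union> snd x)}" for \<phi>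
  proof -
    define S where "S = {v \<in> V. Z \<phi> {v}}"
    define XS where "XS = {x \<in> X. Z \<phi> (fst x \<union> snd x)}"
    define E' where "E' = {e \<in> E. Z \<phi> e} - fst ` XS"
    have "card E' \<le> C * card S"
    proof (rule lin)
      show "e \<subseteq> S" if "e \<in> E'" for e using that E by (auto simp: E'_def S_def Z_def)
      show "(e,f) \<notin> X" if "e \<in> E'" "f \<in> E'" for e f
      proof
        assume "(e,f) \<in> X"
        then have "(e,f) \<in> XS" using that by (auto simp: XS_def E'_def Z_def)
        then have "e \<in> fst ` XS" by force
        then show False using that by (simp add: E'_def)
      qed
    qed (auto simp: E'_def S_def)
    moreover have "card {e \<in> E. Z \<phi> e} - card (fst ` XS) \<le> card E'"
      unfolding E'_def using finX by (intro diff_card_le_card_Diff) (simp add: XS_def)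
    moreover have "card (fst ` XS) \<le> card XS" using finX by (intro card_image_le) (simp add: XS_def)
    ultimately show ?thesis unfolding S_def XS_def by linarith
  qed
  have "(\<Sum>\<phi>\<in>\<Phi>. card {e \<in> E. Z \<phi> e}) \<le> (\<Sum>\<phi>\<in>\<Phi>. C * card {v \<in> V. Z \<phi> {v}} + card {x \<in> X. Z \<phi> (fst x \<union> snd x)})"
    by (rule sum_mono) (rule each)
  then have "(\<Sum>e\<in>E. card {\<phi> \<in> \<Phi>. Z \<phi> e}) \<le> C * (\<Sum>v\<in>V. card {\<phi> \<in> \<Phi>. Z \<phi> {v}})
      + (\<Sum>x\<in>X. card {\<phi> \<in> \<Phi>. Z \<phi> (fst x \<union> snd x)})"
    by (simp add: sum.distrib sum_distrib_left[symmetric] double_count[OF fin\<Phi> finE] double_count[OF fin\<Phi> V]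
        double_count[OF fin\<Phi> finX])
  then have "(\<Sum>e\<in>E. card {\<phi> \<in> \<Phi>. Z \<phi> e}) * N ^ 4 \<le> (C * (\<Sum>v\<in>V. card {\<phi> \<in> \<Phi>. Z \<phi> {v}})
      + (\<Sum>x\<in>X. card {\<phi> \<in> \<Phi>. Z \<phi> (fst x \<union> snd x)})) * N ^ 4"
    by (rule mult_right_mono) simp
  moreover have "(\<Sum>e\<in>E. card {\<phi> \<in> \<Phi>. Z \<phi> e}) * N ^ 4 = card E * N ^ 2 * N ^ card V"
  proof -
    have "card {\<phi> \<in> \<Phi>. Z \<phi> e} * N ^ 4 = N ^ 2 * N ^ card V" if "e \<in> E" for e
      using cZ[of e, symmetric] E[OF that] by (simp add: power_add[symmetric] algebra_simps)
    then show ?thesis by (simp add: sum_distrib_right)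
  qed
  moreover have "(\<Sum>v\<in>V. card {\<phi> \<in> \<Phi>. Z \<phi> {v}}) * N ^ 4 = card V * N ^ 3 * N ^ card V"
  proof -
    have "card {\<phi> \<in> \<Phi>. Z \<phi> {v}} * N ^ 4 = N ^ 3 * N ^ card V" if "v \<in> V" for v
      using cZ[of "{v}", symmetric] that by (simp add: eval_nat_numeral algebra_simps)
    then show ?thesis by (simp add: sum_distrib_right)
  qed
  moreover have "(\<Sum>x\<in>X. card {\<phi> \<in> \<Phi>. Z \<phi> (fst x \<union> snd x)}) * N ^ 4 = card X * N ^ card V"
  proof -
    have "card {\<phi> \<in> \<Phi>. Z \<phi> (fst x \<union> snd x)} * N ^ 4 = N ^ card V" if "x \<in> X" for x
    proof -
      have x: "fst x \<in> E" "snd x \<in> E" "fst x \<inter> snd x = {}" using X that by (cases x; auto)+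
      then have "card (fst x \<union> snd x) = 4"
        using E[OF x(1)] E[OF x(2)] by (subst card_Un_disjoint) (auto simp: card_ge_0_finite)
      then show ?thesis using cZ[of "fst x \<union> snd x"] E[OF x(1)] E[OF x(2)] by simp
    qed
    then show ?thesis by (simp add: sum_distrib_right)
  qed
  ultimately have "card E * N ^ 2 * N ^ card V \<le> (C * card V * N ^ 3 + card X) * N ^ card V"
    by (simp add: algebra_simps)
  then show ?thesis using N by simp
qed

section \<open>Edges routed along paths of a drawing\<close>

definition drawn :: "('v set \<Rightarrow> real \<Rightarrow> complex) \<Rightarrow> 'v set set \<Rightarrow> complex set" where
  "drawn \<gamma> F = (\<Union>g\<in>F. path_image (\<gamma> g))"

definition crossed :: "'v ugraph \<Rightarrow> ('v \<Rightarrow> complex) \<Rightarrow> ('v set \<Rightarrow> real \<Rightarrow> complex) \<Rightarrow> 'v set \<Rightarrow> 'v set set" where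
  "crossed G p \<gamma> e = fst ` crossings G p \<gamma> e"

lemma simple_graph_finite_edges: "simple_graph G \<Longrightarrow> finite (edges G)"
  unfolding simple_graph_def using finite_subset[of "edges G" "Pow (verts G)"] by auto

lemma crossed_subset: "crossed G p \<gamma> e \<subseteq> edges G"
  by (auto simp: crossed_def crossings_def)

lemma drawn_meet_imp_crossed:
  assumes G: "simple_graph G" "drawing G p \<gamma>" and AB: "A \<subseteq> edges G" "B \<subseteq> edges G" "\<Union>A \<inter> \<Union>B = {}"
    and "drawn \<gamma> A \<inter> drawn \<gamma> B \<noteq> {}"
  shows "\<exists>g\<in>A. \<exists>h\<in>B. h \<in> crossed G p \<gamma> g"
proof -
  obtain g h x where gh: "g \<in> A" "h \<in> B" "x \<in> path_image (\<gamma> g)" "x \<in> path_image (\<gamma> h)"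
    using assms(6) unfolding drawn_def by auto
  have g: "g \<in> edges G" "g \<subseteq> verts G" "h \<in> edges G" "h \<subseteq> verts G"
    using gh AB G(1) by (auto simp: simple_graph_def)
  have disj: "g \<inter> h = {}" using gh AB(3) by blast
  have "g \<noteq> {}" using g(1) G(1) by (auto simp: simple_graph_def)
  then have "g \<noteq> h" using disj by auto
  moreover have "x \<notin> p ` verts G"
  proof
    assume "x \<in> p ` verts G"
    then have "x \<in> p ` g" "x \<in> p ` h" using gh g G(2) unfolding drawing_def by blast+
    moreover have "inj_on p (verts G)" using G(2) by (simp add: drawing_def)
    ultimately show False using disj g by (auto simp: inj_on_def subset_iff) (metis disjoint_iff)
  qed
  ultimately have "(h, x) \<in> crossings G p \<gamma> g" using gh g by (auto simp: crossings_def)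
  then show ?thesis using gh unfolding crossed_def by force
qed

text \<open>
  Each edge of a graph with edge set \<open>E\<close> is realised by a set of edges of \<open>G\<close>, such that independent
  edges use disjoint parts of \<open>G\<close> and adjacent edges are drawn with a common point.  Both kinds of
  minors are treated in this form.
\<close>

definition routed :: "'v ugraph \<Rightarrow> ('v set \<Rightarrow> real \<Rightarrow> complex) \<Rightarrow> 'w set set \<Rightarrow> ('w set \<Rightarrow> 'v set set) \<Rightarrow> bool" where
  "routed G \<gamma> E W \<longleftrightarrow>
     (\<forall>e\<in>E. W e \<subseteq> edges G \<and> path_connected (drawn \<gamma> (W e))) \<and>
     (\<forall>e\<in>E. \<forall>f\<in>E. if e \<inter> f = {} then \<Union>(W e) \<inter> \<Union>(W f) = {} else drawn \<gamma> (W e) \<inter> drawn \<gamma> (W f) \<noteq> {})"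

text \<open>
  The images of independent edges can meet only in crossings of \<open>G\<close>, as their routes have no vertex in
  common.  Crossings within a route or between routes of adjacent edges are harmless.
\<close>

lemma routed_independence_drawing:
  assumes G: "simple_graph G" "drawing G p \<gamma>" and W: "routed G \<gamma> E W" and "E' \<subseteq> E"
    and free: "\<And>e f g h. e \<in> E' \<Longrightarrow> f \<in> E' \<Longrightarrow> e \<inter> f = {} \<Longrightarrow> g \<in> W e \<Longrightarrow> h \<in> W f \<Longrightarrow> h \<notin> crossed G p \<gamma> g"
  shows "independence_drawing E' (\<lambda>e. drawn \<gamma> (W e))"
  unfolding independence_drawing_def
proof (intro conjI ballI)
  fix e assume e: "e \<in> E'"
  then have sub: "W e \<subseteq> edges G" using W \<open>E' \<subseteq> E\<close> by (auto simp: routed_def)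
  then have "finite (W e)" using simple_graph_finite_edges[OF G(1)] finite_subset by blast
  moreover have "compact (path_image (\<gamma> g))" if "g \<in> W e" for g
    using that sub G(2) by (auto simp: drawing_def compact_arc_image)
  ultimately show "compact (drawn \<gamma> (W e))" unfolding drawn_def by (intro compact_UN) auto
  show "path_connected (drawn \<gamma> (W e))" using e W \<open>E' \<subseteq> E\<close> by (auto simp: routed_def)
next
  fix e f assume e: "e \<in> E'" and f: "f \<in> E'"
  have sub: "W e \<subseteq> edges G" "W f \<subseteq> edges G" using e f W \<open>E' \<subseteq> E\<close> by (auto simp: routed_def)
  have W': "if e \<inter> f = {} then \<Union>(W e) \<inter> \<Union>(W f) = {} else drawn \<gamma> (W e) \<inter> drawn \<gamma> (W f) \<noteq> {}"
    using e f W \<open>E' \<subseteq> E\<close> unfolding routed_def by blast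
  show "drawn \<gamma> (W e) \<inter> drawn \<gamma> (W f) \<noteq> {} \<longleftrightarrow> e \<inter> f \<noteq> {}"
  proof (cases "e \<inter> f = {}")
    case True
    then show ?thesis
      using W' drawn_meet_imp_crossed[OF G sub] free[OF e f] by auto
  qed (use W' in simp)
qed

text \<open>
  If distinct edges have disjoint routes, each crossing on the route of \<open>e\<close> involves at most one other
  route, so there are at most $L k\,|E|$ crossing pairs of independent edges.
\<close>

lemma routed_disjoint_bound:
  assumes G: "simple_graph G" "drawing G p \<gamma>" and W: "routed G \<gamma> E W"
    and k: "\<And>g. g \<in> edges G \<Longrightarrow> card (crossed G p \<gamma> g) \<le> k"
    and V: "finite V" and E: "\<And>e. e \<in> E \<Longrightarrow> e \<subseteq> V \<and> card e = 2"
    and L: "\<And>e. e \<in> E \<Longrightarrow> card (W e) \<le> L"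
    and disj: "\<And>e f. e \<in> E \<Longrightarrow> f \<in> E \<Longrightarrow> e \<noteq> f \<Longrightarrow> W e \<inter> W f = {}"
    and N: "N \<ge> 1"
  shows "card E * N ^ 2 \<le> 2 ^ 15 * card V * N ^ 3 + L * k * card E"
proof -
  have finE: "finite E" using V E finite_subset[of E "Pow V"] by auto
  have finG: "finite (edges G)" by (rule simple_graph_finite_edges[OF G(1)])
  have WG: "W e \<subseteq> edges G" if "e \<in> E" for e using W that by (simp add: routed_def)
  define T where "T e = {f \<in> E. e \<inter> f = {} \<and> (\<exists>g\<in>W e. \<exists>h\<in>W f. h \<in> crossed G p \<gamma> g)}" for e
  define X where "X = Sigma E T"
  have cT: "card (T e) \<le> L * k" if e: "e \<in> E" for e
  proof -
    define H where "H = (\<Union>g\<in>W e. crossed G p \<gamma> g)"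
    have finW: "finite (W e)" using WG[OF e] finG finite_subset by blast
    have finH: "finite H" unfolding H_def using finite_subset[OF crossed_subset finG] finW by blast
    have "card H \<le> (\<Sum>g\<in>W e. card (crossed G p \<gamma> g))"
      unfolding H_def by (rule card_UN_le[OF finW])
    also have "\<dots> \<le> (\<Sum>g\<in>W e. k)" by (rule sum_mono) (use k WG[OF e] in auto)
    also have "\<dots> \<le> L * k" using L[OF e] by simp
    finally have cH: "card H \<le> L * k" .
    \<comment> \<open>An edge \<open>f\<close> of \<open>T e\<close> is determined by any edge of \<open>G\<close> on its route.\<close>
    have "\<forall>f\<in>T e. \<exists>h. h \<in> W f \<and> h \<in> H" unfolding T_def H_def by blast
    then obtain \<eta> where \<eta>: "\<And>f. f \<in> T e \<Longrightarrow> \<eta> f \<in> W f \<and> \<eta> f \<in> H" by metis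
    have "inj_on \<eta> (T e)"
    proof (rule inj_onI, rule ccontr)
      fix f f' assume ff': "f \<in> T e" "f' \<in> T e" "\<eta> f = \<eta> f'" "f \<noteq> f'"
      then have "W f \<inter> W f' = {}" by (intro disj) (auto simp: T_def)
      then show False using \<eta>[OF ff'(1)] \<eta>[OF ff'(2)] ff'(3) by auto
    qed
    then have "card (T e) \<le> card H" using \<eta> by (intro card_inj_on_le[OF _ _ finH]) auto
    then show ?thesis using cH by simp
  qed
  have "card E * N ^ 2 \<le> 2 ^ 15 * card V * N ^ 3 + card X"
  proof (rule sampling_bound[OF V E _ _ _ N])
    show "X \<subseteq> E \<times> E" by (auto simp: X_def T_def)
    show "e \<inter> f = {}" if "(e,f) \<in> X" for e f using that by (auto simp: X_def T_def)
    fix S E' assume S: "S \<subseteq> V" and E': "E' \<subseteq> E" "\<And>e. e \<in> E' \<Longrightarrow> e \<subseteq> S"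
      and free: "\<And>e f. e \<in> E' \<Longrightarrow> f \<in> E' \<Longrightarrow> (e,f) \<notin> X"
    have "independence_drawing E' (\<lambda>e. drawn \<gamma> (W e))"
    proof (rule routed_independence_drawing[OF G W E'(1)])
      fix e f g h assume "e \<in> E'" "f \<in> E'" "e \<inter> f = {}" "g \<in> W e" "h \<in> W f"
      then show "h \<notin> crossed G p \<gamma> g" using free[of e f] E'(1) by (auto simp: X_def T_def)
    qed
    then show "card E' \<le> 2 ^ 15 * card S"
      by (rule independence_drawing_linear[rotated 2])
        (use S E' E V in \<open>auto intro: finite_subset\<close>)
  qed
  moreover have "card X \<le> L * k * card E"
  proof -
    have "card X = (\<Sum>e\<in>E. card (T e))"
      unfolding X_def using finE by (subst card_SigmaI) (auto simp: T_def)
    also have "\<dots> \<le> (\<Sum>e\<in>E. L * k)" by (rule sum_mono) (rule cT)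
    finally show ?thesis by (simp add: mult.commute)
  qed
  ultimately show ?thesis by linarith
qed

text \<open>
  Here a single edge of \<open>G\<close> may lie on the routes of arbitrarily many edges, as happens inside a branch set
  with a large number of neighbours, so crossing pairs cannot be counted.  Instead, a random
  set $K$ of edges of $G$ is kept.  An edge of the minor is good if its route is contained in $K$ and
  every edge that crosses its route, without belonging to it, is outside $K$.  This happens with
  probability at least $2^{-L(k+1)}$.  If routes of independent good edges crossed at \<open>g\<close> and \<open>h\<close>,
  then \<open>h\<close> would be kept, hence would lie on both routes, which is impossible.
\<close>

lemma routed_bound:
  assumes G: "simple_graph G" "drawing G p \<gamma>" and W: "routed G \<gamma> E W"
    and k: "\<And>g. g \<in> edges G \<Longrightarrow> card (crossed G p \<gamma> g) \<le> k"
    and V: "finite V" and E: "\<And>e. e \<in> E \<Longrightarrow> e \<subseteq> V \<and> card e = 2"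
    and L: "\<And>e. e \<in> E \<Longrightarrow> card (W e) \<le> L"
  shows "card E \<le> 2 ^ 15 * card V * 2 ^ (L * (k + 1))"
proof -
  have finE: "finite E" using V E finite_subset[of E "Pow V"] by auto
  have finG: "finite (edges G)" by (rule simple_graph_finite_edges[OF G(1)])
  have WG: "W e \<subseteq> edges G" if "e \<in> E" for e using W that by (simp add: routed_def)
  define D where "D e = (\<Union>g\<in>W e. crossed G p \<gamma> g) - W e" for e
  have DG: "D e \<subseteq> edges G" for e using crossed_subset by (fastforce simp: D_def)
  define M where "M = L * (k + 1)"
  have cWD: "card (W e \<union> D e) \<le> M" if e: "e \<in> E" for e
  proof -
    have finW: "finite (W e)" using WG[OF e] finG finite_subset by blast
    have "card (\<Union>g\<in>W e. crossed G p \<gamma> g) \<le> (\<Sum>g\<in>W e. card (crossed G p \<gamma> g))"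
      by (rule card_UN_le[OF finW])
    also have "\<dots> \<le> (\<Sum>g\<in>W e. k)" by (rule sum_mono) (use k WG[OF e] in auto)
    also have "\<dots> \<le> L * k" using L[OF e] by simp
    finally have "card (W e) + card (\<Union>g\<in>W e. crossed G p \<gamma> g) \<le> M"
      using L[OF e] by (simp add: M_def)
    moreover have "W e \<union> D e = W e \<union> (\<Union>g\<in>W e. crossed G p \<gamma> g)" by (auto simp: D_def)
    ultimately show ?thesis using card_Un_le[of "W e" "\<Union>g\<in>W e. crossed G p \<gamma> g"] by simp
  qed
  define good where "good K e \<longleftrightarrow> W e \<subseteq> K \<and> K \<inter> D e = {}" for K e
  have many: "2 ^ card (edges G) \<le> card {K \<in> Pow (edges G). good K e} * 2 ^ M" if e: "e \<in> E" for e
  proof -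
    have "2 ^ card (edges G) = card {K \<in> Pow (edges G). good K e} * 2 ^ card (W e \<union> D e)"
      unfolding good_def by (rule card_subsets_between[OF finG WG[OF e] DG, symmetric]) (auto simp: D_def)
    also have "\<dots> \<le> card {K \<in> Pow (edges G). good K e} * 2 ^ M"
      using cWD[OF e] by (intro mult_left_mono power_increasing) auto
    finally show ?thesis .
  qed
  have few: "card {e \<in> E. good K e} \<le> 2 ^ 15 * card V" for K
  proof -
    have "independence_drawing {e \<in> E. good K e} (\<lambda>e. drawn \<gamma> (W e))"
    proof (rule routed_independence_drawing[OF G W])
      fix e f g h assume ef: "e \<in> {e \<in> E. good K e}" "f \<in> {e \<in> E. good K e}" "e \<inter> f = {}" "g \<in> W e" "h \<in> W f"
      have "\<Union>(W e) \<inter> \<Union>(W f) = {}" using ef W by (auto simp: routed_def)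
      moreover have "h \<noteq> {}" using ef(2,5) WG G(1) by (fastforce simp: simple_graph_def)
      ultimately have "h \<notin> W e" using ef(5) by blast
      moreover have "h \<notin> D e" using ef by (auto simp: good_def)
      ultimately show "h \<notin> crossed G p \<gamma> g" using ef(4) by (auto simp: D_def)
    qed auto
    then show ?thesis by (rule independence_drawing_linear[rotated 2]) (use V E in auto)
  qed
  have "card E * 2 ^ card (edges G) = (\<Sum>e\<in>E. 2 ^ card (edges G))" by simp
  also have "\<dots> \<le> (\<Sum>e\<in>E. card {K \<in> Pow (edges G). good K e} * 2 ^ M)"
    by (rule sum_mono) (rule many)
  also have "\<dots> = (\<Sum>K\<in>Pow (edges G). card {e \<in> E. good K e}) * 2 ^ M"
    using finG finE by (simp add: double_count[of "Pow (edges G)" E] sum_distrib_right)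
  also have "\<dots> \<le> (\<Sum>K\<in>Pow (edges G). 2 ^ 15 * card V) * 2 ^ M"
    by (intro mult_right_mono sum_mono few) simp
  also have "\<dots> = 2 ^ 15 * card V * 2 ^ M * 2 ^ card (edges G)"
    using finG by (simp add: card_Pow)
  finally show ?thesis by (simp add: M_def)
qed

section \<open>Routes for shallow topological minors and shallow minors\<close>

definition walk_edges :: "(nat \<Rightarrow> 'v) \<Rightarrow> nat \<Rightarrow> 'v set set" where
  "walk_edges f n = (\<lambda>i. {f i, f (Suc i)}) ` {..<n}"

lemma drawing_edge:
  assumes "drawing G p \<gamma>" "e \<in> edges G"
  shows "path_connected (path_image (\<gamma> e))" "v \<in> e \<Longrightarrow> p v \<in> path_image (\<gamma> e)"
proof -
  have e: "arc (\<gamma> e)" "{pathstart (\<gamma> e), pathfinish (\<gamma> e)} = p ` e"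
    using assms by (auto simp: drawing_def)
  show "path_connected (path_image (\<gamma> e))"
    using e(1) by (simp add: arc_imp_path path_connected_path_image)
  assume "v \<in> e"
  then have "p v \<in> {pathstart (\<gamma> e), pathfinish (\<gamma> e)}" using e(2) by auto
  then show "p v \<in> path_image (\<gamma> e)" by auto
qed

lemma drawn_vertex:
  "drawing G p \<gamma> \<Longrightarrow> F \<subseteq> edges G \<Longrightarrow> e \<in> F \<Longrightarrow> v \<in> e \<Longrightarrow> p v \<in> drawn \<gamma> F"
  using drawing_edge(2)[of G p \<gamma> e v] by (auto simp: drawn_def)

lemma walk_drawn:
  assumes "drawing G p \<gamma>" "walk_edges f n \<subseteq> edges G"
  shows "path_connected (insert (p (f 0)) (drawn \<gamma> (walk_edges f n))) \<and>
    p (f n) \<in> insert (p (f 0)) (drawn \<gamma> (walk_edges f n))"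
  using assms(2)
proof (induction n)
  case 0
  then show ?case by (simp add: walk_edges_def drawn_def)
next
  case (Suc n)
  define e where "e = {f n, f (Suc n)}"
  have W: "walk_edges f (Suc n) = insert e (walk_edges f n)"
    by (simp add: walk_edges_def lessThan_Suc e_def)
  then have e: "e \<in> edges G" "walk_edges f n \<subseteq> edges G" using Suc.prems by auto
  have "drawn \<gamma> (walk_edges f (Suc n)) = path_image (\<gamma> e) \<union> drawn \<gamma> (walk_edges f n)"
    by (simp add: W drawn_def)
  then have eq: "insert (p (f 0)) (drawn \<gamma> (walk_edges f (Suc n))) =
      insert (p (f 0)) (drawn \<gamma> (walk_edges f n)) \<union> path_image (\<gamma> e)" by auto
  have "p (f n) \<in> path_image (\<gamma> e)" "p (f (Suc n)) \<in> path_image (\<gamma> e)"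
    using drawing_edge(2)[OF assms(1) e(1)] by (auto simp: e_def)
  then show ?case
    unfolding eq using Suc.IH[OF e(2)] drawing_edge(1)[OF assms(1) e(1)]
    by (intro conjI path_connected_Un) blast+
qed

lemma card_walk_edges: "card (walk_edges f n) \<le> n"
  unfolding walk_edges_def using card_image_le[of "{..<n}"] by force

text \<open>
  The route of an edge is the path that replaces it.
\<close>

lemma topological_minor_routed:
  assumes dr: "drawing G p \<gamma>" and tm: "shallow_topological_minor d H G"
  obtains W where "routed G \<gamma> (edges H) W" "\<And>e. e \<in> edges H \<Longrightarrow> card (W e) \<le> 2 * d + 1"
    "\<And>e f. e \<in> edges H \<Longrightarrow> f \<in> edges H \<Longrightarrow> e \<noteq> f \<Longrightarrow> W e \<inter> W f = {}"
proof -
  have H: "simple_graph H" using tm by (simp add: shallow_topological_minor_def)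
  obtain S F \<phi> where S: "subdivision_le (2 * d) H S" and F: "subgraph F G"
    and \<phi>: "bij_betw \<phi> (verts S) (verts F)" "edges F = (\<lambda>e. \<phi> ` e) ` edges S"
    using tm unfolding shallow_topological_minor_def isomorphic_def by blast
  obtain P where all: "(\<forall>e\<in>edges H. P e \<noteq> [] \<and> distinct (P e) \<and> {hd (P e), last (P e)} = e \<and>
            length (P e) \<le> 2 * d + 2 \<and> set (P e) \<inter> verts H = e) \<and>
      (\<forall>e\<in>edges H. \<forall>f\<in>edges H. e \<noteq> f \<longrightarrow> set (P e) \<inter> set (P f) \<subseteq> verts H) \<and>
      verts S = verts H \<union> (\<Union>e\<in>edges H. set (P e)) \<and> edges S = (\<Union>e\<in>edges H. path_edges (P e))"
    using S unfolding subdivision_le_def by (elim exE)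
  then have P: "P e \<noteq> [] \<and> distinct (P e) \<and> {hd (P e), last (P e)} = e \<and>
            length (P e) \<le> 2 * d + 2 \<and> set (P e) \<inter> verts H = e" if "e \<in> edges H" for e
    using that by simp
  have PP: "set (P e) \<inter> set (P f) \<subseteq> verts H" if "e \<in> edges H" "f \<in> edges H" "e \<noteq> f" for e f
    using all that by simp
  have vS: "verts S = verts H \<union> (\<Union>e\<in>edges H. set (P e))"
    and eS: "edges S = (\<Union>e\<in>edges H. path_edges (P e))"
    using all by simp_all
  have inj: "inj_on \<phi> (verts S)" using \<phi>(1) by (rule bij_betw_imp_inj_on)
  define N where "N e = length (P e) - 1" for e
  define w where "w e i = \<phi> (P e ! i)" for e i
  define W where "W e = walk_edges (w e) (N e)" for e
  have W_eq: "W e = (\<lambda>g. \<phi> ` g) ` path_edges (P e)" for e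
  proof -
    have "path_edges (P e) = (\<lambda>i. {P e ! i, P e ! Suc i}) ` {..<N e}"
      by (auto simp: path_edges_def N_def)
    then show ?thesis by (simp add: W_def walk_edges_def image_image w_def)
  qed
  have len: "length (P e) \<ge> 2" if e: "e \<in> edges H" for e
  proof (rule ccontr)
    assume "\<not> 2 \<le> length (P e)"
    moreover have "length (P e) > 0" using P[OF e] by simp
    ultimately have "length (P e) = 1" by linarith
    then obtain x where "P e = [x]" by (auto simp: length_Suc_conv)
    then have "e = {x}" using P[OF e] by simp
    moreover have "card e = 2" using H e by (simp add: simple_graph_def)
    ultimately show False by simp
  qed
  have WG: "W e \<subseteq> edges G" if "e \<in> edges H" for e
    using that F \<phi>(2) eS unfolding W_eq subgraph_def by blast
  have hub: "p (\<phi> v) \<in> drawn \<gamma> (W e)" if e: "e \<in> edges H" and v: "v \<in> e" for e v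
  proof -
    have "v = hd (P e) \<or> v = last (P e)" using P[OF e] v by blast
    moreover have "Suc (N e - 1) = length (P e) - 1" using len[OF e] by (simp add: N_def)
    ultimately have "\<phi> v = w e 0 \<or> \<phi> v = w e (Suc (N e - 1))"
      using P[OF e] by (auto simp: w_def hd_conv_nth last_conv_nth)
    moreover have "{w e 0, w e (Suc 0)} \<in> W e" "{w e (N e - 1), w e (Suc (N e - 1))} \<in> W e"
      using len[OF e] by (auto simp: W_def walk_edges_def N_def)
    ultimately show ?thesis using drawn_vertex[OF dr WG[OF e]] by auto
  qed
  have sub: "\<Union>(W e) \<subseteq> \<phi> ` set (P e)" for e
    unfolding W_eq path_edges_def by auto
  show ?thesis
  proof (rule that)
    show "routed G \<gamma> (edges H) W"
      unfolding routed_def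
    proof (intro conjI ballI)
      fix e assume e: "e \<in> edges H"
      show "W e \<subseteq> edges G" by (rule WG[OF e])
      have "p (\<phi> (hd (P e))) \<in> drawn \<gamma> (W e)" using P[OF e] by (intro hub[OF e]) blast
      then have "insert (p (w e 0)) (drawn \<gamma> (W e)) = drawn \<gamma> (W e)"
        using P[OF e] by (auto simp: w_def hd_conv_nth)
      then show "path_connected (drawn \<gamma> (W e))"
        using walk_drawn[OF dr, of "w e" "N e"] WG[OF e] by (simp add: W_def)
    next
      fix e f assume e: "e \<in> edges H" and f: "f \<in> edges H"
      have "\<Union>(W e) \<inter> \<Union>(W f) = {}" if "e \<inter> f = {}"
      proof -
        have "e \<noteq> f" using that P[OF e] by auto
        then have "set (P e) \<inter> set (P f) \<subseteq> (set (P e) \<inter> verts H) \<inter> (set (P f) \<inter> verts H)"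
          using PP[OF e f] by blast
        then have "set (P e) \<inter> set (P f) = {}" using P[OF e] P[OF f] that by simp
        moreover have "set (P e) \<subseteq> verts S" "set (P f) \<subseteq> verts S" using e f vS by blast+
        ultimately have "\<phi> ` set (P e) \<inter> \<phi> ` set (P f) = {}"
          using inj_on_image_Int[OF inj, of "set (P e)" "set (P f)"] by simp
        then show ?thesis using sub[of e] sub[of f] by blast
      qed
      moreover have "drawn \<gamma> (W e) \<inter> drawn \<gamma> (W f) \<noteq> {}" if "e \<inter> f \<noteq> {}"
        using that hub[OF e] hub[OF f] by blast
      ultimately show "if e \<inter> f = {} then \<Union>(W e) \<inter> \<Union>(W f) = {} else drawn \<gamma> (W e) \<inter> drawn \<gamma> (W f) \<noteq> {}"
        by simp
    qed
    show "card (W e) \<le> 2 * d + 1" if "e \<in> edges H" for e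
      using card_walk_edges[of "w e" "N e"] P[OF that] unfolding W_def N_def by linarith
    show "W e \<inter> W f = {}" if ef: "e \<in> edges H" "f \<in> edges H" "e \<noteq> f" for e f
    proof (rule ccontr)
      assume "W e \<inter> W f \<noteq> {}"
      then obtain g h where gh: "g \<in> path_edges (P e)" "h \<in> path_edges (P f)" "\<phi> ` g = \<phi> ` h"
        unfolding W_eq by auto
      have g: "g \<subseteq> set (P e)" and h: "h \<subseteq> set (P f)"
        using gh(1,2) by (auto simp: path_edges_def)
      obtain i where i: "g = {P e ! i, P e ! Suc i}" "Suc i < length (P e)"
        using gh(1) by (auto simp: path_edges_def)
      then have "P e ! i \<noteq> P e ! Suc i" using P[OF ef(1)] by (simp add: nth_eq_iff_index_eq)
      then have cg: "card g = 2" using i(1) by simp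
      have "g \<subseteq> verts S" "h \<subseteq> verts S" using g h ef(1,2) vS by blast+
      then have "g = h" using gh(3) inj by (simp add: inj_on_image_eq_iff)
      then have "g \<subseteq> set (P e) \<inter> verts H" "g \<subseteq> set (P f) \<inter> verts H"
        using g h PP[OF ef] by blast+
      then have "g \<subseteq> e" "g \<subseteq> f" using P[OF ef(1)] P[OF ef(2)] by simp_all
      moreover have "card e = 2" "card f = 2" using H ef by (auto simp: simple_graph_def)
      ultimately have "g = e" "g = f" using cg by (metis card_ge_0_finite card_subset_eq zero_less_numeral)+
      then show False using ef(3) by simp
    qed
  qed
qed

lemma adj_sym: "adj G u v \<Longrightarrow> adj G v u"
  by (simp add: adj_def insert_commute)

lemma adj_rtranclp_sym: "(adj G)\<^sup>*\<^sup>* u v \<Longrightarrow> (adj G)\<^sup>*\<^sup>* v u"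
  using symp_rtranclp[of "adj G"] by (auto simp: symp_def adj_sym)

lemma adj_rtranclp_verts:
  assumes "simple_graph X" "u \<in> verts X" "(adj X)\<^sup>*\<^sup>* u v"
  shows "v \<in> verts X"
  using assms(3,1,2) by (induction rule: rtranclp_induct) (auto simp: simple_graph_def adj_def)

text \<open>
  Distances are measured in the component itself, so the walks from a central vertex stay inside it.
\<close>

lemma component_center:
  assumes X: "simple_graph X" and C: "C \<in> graph_components X" "graph_radius C \<le> d"
  shows "\<exists>r\<in>verts C. \<forall>v\<in>verts C. \<exists>n\<le>d. \<exists>f. f 0 = r \<and> f n = v \<and>
    walk_edges f n \<subseteq> edges X \<and> \<Union>(walk_edges f n) \<subseteq> verts C"
proof -
  obtain u where u: "u \<in> verts X" "C = induced X {v. (adj X)\<^sup>*\<^sup>* u v}"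
    using C(1) by (auto simp: graph_components_def)
  define K where "K = {v. (adj X)\<^sup>*\<^sup>* u v}"
  have vC: "verts C = K" and eC: "edges C = {e \<in> edges X. e \<subseteq> K}"
    by (simp_all add: u(2) K_def induced_def)
  have "K \<subseteq> verts X" using adj_rtranclp_verts[OF X u(1)] by (auto simp: K_def)
  then have finK: "finite K" using X finite_subset by (auto simp: simple_graph_def)
  have "u \<in> K" by (simp add: K_def)
  then have "graph_radius C \<in> (\<lambda>r. MAX v\<in>K. graph_dist C r v) ` K"
    unfolding graph_radius_def vC using finK by (intro Min_in) auto
  then obtain r where r: "r \<in> K" "graph_radius C = (MAX v\<in>K. graph_dist C r v)" by auto
  have "\<exists>n\<le>d. \<exists>f. f 0 = r \<and> f n = v \<and> walk_edges f n \<subseteq> edges X \<and> \<Union>(walk_edges f n) \<subseteq> verts C"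
    if v: "v \<in> K" for v
  proof -
    have "(adj X)\<^sup>*\<^sup>* r v"
      using r(1) v adj_rtranclp_sym[of X u r] unfolding K_def by (auto intro: rtranclp_trans)
    then have "(adj C)\<^sup>*\<^sup>* r v"
    proof (induction rule: rtranclp_induct)
      case (step y z)
      have "(adj X)\<^sup>*\<^sup>* u y" using r(1) step(1) unfolding K_def by (auto intro: rtranclp_trans)
      then have "y \<in> K" "z \<in> K" using step(2) by (auto simp: K_def intro: rtranclp.rtrancl_into_rtrancl)
      then have "adj C y z" using step(2) by (simp add: adj_def eC)
      then show ?case using step.IH by (rule rtranclp.rtrancl_into_rtrancl[rotated])
    qed simp
    then obtain m where "(adj C ^^ m) r v" using rtranclp_imp_relpowp by metis
    then have "(adj C ^^ graph_dist C r v) r v" unfolding graph_dist_def by (rule LeastI)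
    moreover have "graph_dist C r v \<le> d"
      using Max_ge[of "graph_dist C r ` K" "graph_dist C r v"] finK v r(2) C(2)
      by (metis finite_imageI imageI order_trans)
    moreover obtain f where f: "f 0 = r" "f (graph_dist C r v) = v"
        "\<forall>i<graph_dist C r v. adj C (f i) (f (Suc i))"
      using calculation(1) unfolding relpowp_fun_conv by blast
    moreover have "walk_edges f (graph_dist C r v) \<subseteq> edges C"
      using f(3) by (auto simp: walk_edges_def adj_def)
    ultimately show ?thesis unfolding vC eC by blast
  qed
  then show ?thesis using r(1) unfolding vC by blast
qed

lemma block_center:
  assumes X: "subgraph X G" and rad: "\<forall>C\<in>graph_components X. graph_radius C \<le> d"
    and B: "B \<in> verts (contract G X)"
  shows "\<exists>r\<in>B. \<forall>v\<in>B. \<exists>n\<le>d. \<exists>f. f 0 = r \<and> f n = v \<and>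
    walk_edges f n \<subseteq> edges G \<and> \<Union>(walk_edges f n) \<subseteq> B"
proof -
  consider C where "C \<in> graph_components X" "B = verts C" | v where "B = {v}"
    using B by (auto simp: contract_def Let_def)
  then show ?thesis
  proof cases
    case 1
    have "simple_graph X" "edges X \<subseteq> edges G" using X by (auto simp: subgraph_def)
    then show ?thesis using component_center[of X C d] rad 1 by (meson order_trans)
  next
    case 2
    have "\<exists>n\<le>d. \<exists>f. f 0 = v \<and> f n = v \<and> walk_edges f n \<subseteq> edges G \<and> \<Union>(walk_edges f n) \<subseteq> {v}"
      by (intro exI[of _ 0] conjI exI[of _ "\<lambda>_. v"]) (auto simp: walk_edges_def)
    then show ?thesis unfolding 2 by (simp only: bex_simps ball_simps simp_thms)
  qed
qed

lemma blocks_disjoint: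
  assumes X: "subgraph X G" and B: "B \<in> verts (contract G X)" "B' \<in> verts (contract G X)" "B \<noteq> B'"
  shows "B \<inter> B' = {}"
proof (rule ccontr)
  assume "B \<inter> B' \<noteq> {}"
  then obtain w where w: "w \<in> B" "w \<in> B'" by blast
  have sX: "simple_graph X" using X by (simp add: subgraph_def)
  have block: "A = (if w \<in> verts X then {v. (adj X)\<^sup>*\<^sup>* w v} else {w})"
    if A: "A \<in> verts (contract G X)" "w \<in> A" for A
  proof -
    consider u where "u \<in> verts X" "A = {v. (adj X)\<^sup>*\<^sup>* u v}" | v where "v \<notin> verts X" "A = {v}"
      using A(1) by (auto simp: contract_def Let_def graph_components_def induced_def)
    then show ?thesis
    proof cases
      case 1
      then have uw: "(adj X)\<^sup>*\<^sup>* u w" "(adj X)\<^sup>*\<^sup>* w u" using A(2) adj_rtranclp_sym by auto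
      then have "w \<in> verts X" using adj_rtranclp_verts[OF sX 1(1)] by blast
      then show ?thesis using 1(2) uw by (auto intro: rtranclp_trans)
    qed (use A(2) in auto)
  qed
  show False using block[OF B(1) w(1)] block[OF B(2) w(2)] B(3) by simp
qed

text \<open>
  The route of an edge between two branch sets runs from the centre of one to an edge between them and
  on to the centre of the other, so it has at most $d + 1 + d$ edges, and routes of adjacent
  edges share a centre.
\<close>

lemma shallow_minor_routed:
  assumes dr: "drawing G p \<gamma>" and sm: "shallow_minor d H G"
  obtains W where "routed G \<gamma> (edges H) W" "\<And>e. e \<in> edges H \<Longrightarrow> card (W e) \<le> 2 * d + 1"
proof -
  obtain X where X: "subgraph X G" "\<forall>C\<in>graph_components X. graph_radius C \<le> d"
    and HX: "subgraph H (contract G X)"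
    using sm by (auto simp: shallow_minor_def)
  define \<B> where "\<B> = verts (contract G X)"
  obtain r where r: "\<And>B. B \<in> \<B> \<Longrightarrow> \<forall>v\<in>B. \<exists>n\<le>d. \<exists>f. f 0 = r B \<and> f n = v \<and>
      walk_edges f n \<subseteq> edges G \<and> \<Union>(walk_edges f n) \<subseteq> B"
    using block_center[OF X] unfolding \<B>_def by metis
  have disj: "B \<inter> B' = {}" if "B \<in> \<B>" "B' \<in> \<B>" "B \<noteq> B'" for B B'
    using blocks_disjoint[OF X(1)] that unfolding \<B>_def by blast
  have eB: "\<exists>P Q a b. e = {P,Q} \<and> P \<in> \<B> \<and> Q \<in> \<B> \<and> a \<in> P \<and> b \<in> Q \<and> {a,b} \<in> edges G" if "e \<in> edges H" for e
  proof -
    have "e \<in> edges (contract G X)" using HX that by (auto simp: subgraph_def)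
    then show ?thesis unfolding \<B>_def by (auto simp: contract_def Let_def adj_def)
  qed
  have "\<exists>F. F \<subseteq> edges G \<and> card F \<le> 2 * d + 1 \<and> path_connected (drawn \<gamma> F) \<and> \<Union>F \<subseteq> \<Union>e \<and>
      (\<forall>B\<in>e. p (r B) \<in> drawn \<gamma> F)" if e: "e \<in> edges H" for e
  proof -
    obtain P Q a b where PQ: "e = {P,Q}" "P \<in> \<B>" "Q \<in> \<B>" "a \<in> P" "b \<in> Q" "{a,b} \<in> edges G"
      using eB[OF e] by blast
    obtain n f where f: "n \<le> d" "f 0 = r P" "f n = a" "walk_edges f n \<subseteq> edges G" "\<Union>(walk_edges f n) \<subseteq> P"
      using r[OF PQ(2)] PQ(4) by blast
    obtain m g where g: "m \<le> d" "g 0 = r Q" "g m = b" "walk_edges g m \<subseteq> edges G" "\<Union>(walk_edges g m) \<subseteq> Q"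
      using r[OF PQ(3)] PQ(5) by blast
    define F where "F = walk_edges f n \<union> {{a,b}} \<union> walk_edges g m"
    have FG: "F \<subseteq> edges G" using f g PQ by (simp add: F_def)
    have "card F \<le> card (walk_edges f n) + card {{a,b}} + card (walk_edges g m)"
      unfolding F_def by (rule order_trans[OF card_Un_le add_right_mono[OF card_Un_le]])
    then have cF: "card F \<le> 2 * d + 1"
      using card_walk_edges[of f n] card_walk_edges[of g m] f(1) g(1) by simp
    have start: "p (h 0) \<in> drawn \<gamma> F" if "walk_edges h k \<subseteq> F" "h k = a \<or> h k = b" for h k
    proof (cases k)
      case 0
      then show ?thesis using drawn_vertex[OF dr FG, of "{a,b}" "h 0"] that(2) by (auto simp: F_def)
    next
      case (Suc k')
      then have "{h 0, h (Suc 0)} \<in> F" using that(1) by (auto simp: walk_edges_def)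
      then show ?thesis using drawn_vertex[OF dr FG] by blast
    qed
    have rP: "p (r P) \<in> drawn \<gamma> F" using start[of f n] f by (auto simp: F_def)
    have rQ: "p (r Q) \<in> drawn \<gamma> F" using start[of g m] g by (auto simp: F_def)
    have ab: "p a \<in> path_image (\<gamma> {a,b})" "p b \<in> path_image (\<gamma> {a,b})"
      using drawing_edge(2)[OF dr PQ(6)] by auto
    have "drawn \<gamma> F = drawn \<gamma> (walk_edges f n) \<union> path_image (\<gamma> {a,b}) \<union> drawn \<gamma> (walk_edges g m)"
      by (auto simp: F_def drawn_def)
    then have eq: "drawn \<gamma> F = (insert (p (f 0)) (drawn \<gamma> (walk_edges f n)) \<union> path_image (\<gamma> {a,b}))
        \<union> insert (p (g 0)) (drawn \<gamma> (walk_edges g m))"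
      using rP rQ f(2) g(2) by auto
    have "path_connected (drawn \<gamma> F)"
      unfolding eq
    proof (intro path_connected_Un)
      show "path_connected (insert (p (f 0)) (drawn \<gamma> (walk_edges f n)))"
        "path_connected (insert (p (g 0)) (drawn \<gamma> (walk_edges g m)))"
        using walk_drawn[OF dr f(4)] walk_drawn[OF dr g(4)] by blast+
      show "path_connected (path_image (\<gamma> {a,b}))" by (rule drawing_edge(1)[OF dr PQ(6)])
      show "insert (p (f 0)) (drawn \<gamma> (walk_edges f n)) \<inter> path_image (\<gamma> {a,b}) \<noteq> {}"
        using walk_drawn[OF dr f(4)] ab f(3) by blast
      show "(insert (p (f 0)) (drawn \<gamma> (walk_edges f n)) \<union> path_image (\<gamma> {a,b}))
          \<inter> insert (p (g 0)) (drawn \<gamma> (walk_edges g m)) \<noteq> {}"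
        using walk_drawn[OF dr g(4)] ab g(3) by blast
    qed
    moreover have "\<Union>F \<subseteq> \<Union>e" using f(5) g(5) PQ unfolding F_def by auto
    ultimately show ?thesis using FG cF rP rQ PQ(1) by blast
  qed
  then obtain W where W: "\<And>e. e \<in> edges H \<Longrightarrow> W e \<subseteq> edges G \<and> card (W e) \<le> 2 * d + 1 \<and>
      path_connected (drawn \<gamma> (W e)) \<and> \<Union>(W e) \<subseteq> \<Union>e \<and> (\<forall>B\<in>e. p (r B) \<in> drawn \<gamma> (W e))"
    by metis
  show ?thesis
  proof (rule that)
    show "routed G \<gamma> (edges H) W"
      unfolding routed_def
    proof (intro conjI ballI)
      fix e f assume e: "e \<in> edges H" and f: "f \<in> edges H"
      have sub: "e \<subseteq> \<B>" "f \<subseteq> \<B>" using eB[OF e] eB[OF f] by blast+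
      have "\<Union>(W e) \<inter> \<Union>(W f) = {}" if "e \<inter> f = {}"
      proof -
        have "B \<inter> B' = {}" if "B \<in> e" "B' \<in> f" for B B'
          using disj[of B B'] sub that \<open>e \<inter> f = {}\<close> by blast
        then have "\<Union>e \<inter> \<Union>f = {}" by blast
        moreover have "\<Union>(W e) \<subseteq> \<Union>e" "\<Union>(W f) \<subseteq> \<Union>f" using W[OF e] W[OF f] by simp_all
        ultimately show ?thesis by blast
      qed
      moreover have "drawn \<gamma> (W e) \<inter> drawn \<gamma> (W f) \<noteq> {}" if "e \<inter> f \<noteq> {}"
      proof -
        obtain B where "B \<in> e" "B \<in> f" using \<open>e \<inter> f \<noteq> {}\<close> by blast
        then have "p (r B) \<in> drawn \<gamma> (W e)" "p (r B) \<in> drawn \<gamma> (W f)"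
          using W[OF e] W[OF f] by simp_all
        then show ?thesis by blast
      qed
      ultimately show "if e \<inter> f = {} then \<Union>(W e) \<inter> \<Union>(W f) = {} else drawn \<gamma> (W e) \<inter> drawn \<gamma> (W f) \<noteq> {}"
        by simp
    qed (use W in auto)
  qed (use W in auto)
qed

section \<open>Graphs with few crossings per edge\<close>

lemma card_crossed_le:
  assumes "finite (crossings G p \<gamma> e)" "real (card (crossings G p \<gamma> e)) \<le> c"
  shows "card (crossed G p \<gamma> e) \<le> nat \<lfloor>c\<rfloor>"
proof -
  have "card (crossed G p \<gamma> e) \<le> card (crossings G p \<gamma> e)"
    unfolding crossed_def by (rule card_image_le[OF assms(1)])
  also have "\<dots> \<le> nat \<lfloor>c\<rfloor>" using assms(2) by (simp add: le_nat_floor)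
  finally show ?thesis .
qed

lemma crossing_class_drawing:
  assumes "G \<in> crossing_class c"
  obtains p \<gamma> where "simple_graph G" "drawing G p \<gamma>"
    "\<And>g. g \<in> edges G \<Longrightarrow> card (crossed G p \<gamma> g) \<le> nat \<lfloor>c\<rfloor>"
  using assms card_crossed_le
  unfolding crossing_class_def drawable_with_crossings_per_edge_def by blast

theorem crossing_class_bounded_expansion: "bounded_expansion (crossing_class c :: 'v ugraph set)"
  unfolding bounded_expansion_def
proof (intro exI allI)
  fix d :: nat
  show "grad d (crossing_class c :: 'v ugraph set) \<le> ereal (2 ^ 15 * 2 ^ ((2 * d + 1) * (nat \<lfloor>c\<rfloor> + 1)))"
    unfolding grad_def
  proof (rule SUP_least, clarify)
    fix H :: "'v set ugraph" and G :: "'v ugraph"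
    assume H: "verts H \<noteq> {}" and G: "G \<in> crossing_class c" and HG: "shallow_minor d H G"
    obtain p \<gamma> where dr: "simple_graph G" "drawing G p \<gamma>"
      "\<And>g. g \<in> edges G \<Longrightarrow> card (crossed G p \<gamma> g) \<le> nat \<lfloor>c\<rfloor>"
      using crossing_class_drawing[OF G] by blast
    have sH: "simple_graph H" using HG by (auto simp: shallow_minor_def subgraph_def)
    obtain W where W: "routed G \<gamma> (edges H) W" "\<And>e. e \<in> edges H \<Longrightarrow> card (W e) \<le> 2 * d + 1"
      using shallow_minor_routed[OF dr(2) HG] by blast
    have "card (edges H) \<le> 2 ^ 15 * card (verts H) * 2 ^ ((2 * d + 1) * (nat \<lfloor>c\<rfloor> + 1))"
      by (rule routed_bound[OF dr(1,2) W(1) dr(3)])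
        (use sH W(2) in \<open>auto simp: simple_graph_def\<close>)
    then have "real (card (edges H)) \<le> real (2 ^ 15 * card (verts H) * 2 ^ ((2 * d + 1) * (nat \<lfloor>c\<rfloor> + 1)))"
      by (rule of_nat_mono)
    moreover have "card (verts H) > 0" using H sH by (simp add: simple_graph_def card_gt_0_iff)
    ultimately show "ereal (density H) \<le> ereal (2 ^ 15 * 2 ^ ((2 * d + 1) * (nat \<lfloor>c\<rfloor> + 1)))"
      by (simp add: density_def divide_le_eq algebra_simps)
  qed
qed

text \<open>
  With $N$ close to $3\sqrt{cd}$, the number $(2d+1)c$ of crossings on a route is at most $N^2/2$, so the
  crossing term in the averaging bound absorbs at most half of its left-hand side.  What remains is
  $|E| \le 2^{16} N |V|$.
\<close>

theorem crossing_class_topological_grad: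
  assumes c: "c \<ge> 1" and G: "G \<in> crossing_class c" and d: "d \<ge> 1"
  shows "topological_grad d G \<le> ereal (2 ^ 18 * sqrt (c * real d))"
  unfolding topological_grad_def
proof (rule SUP_least, clarify)
  fix H :: "nat ugraph"
  assume H: "verts H \<noteq> {}" and HG: "shallow_topological_minor d H G"
  obtain p \<gamma> where dr: "simple_graph G" "drawing G p \<gamma>"
    "\<And>g. g \<in> edges G \<Longrightarrow> card (crossed G p \<gamma> g) \<le> nat \<lfloor>c\<rfloor>"
    using crossing_class_drawing[OF G] by blast
  have sH: "simple_graph H" using HG by (simp add: shallow_topological_minor_def)
  obtain W where W: "routed G \<gamma> (edges H) W" "\<And>e. e \<in> edges H \<Longrightarrow> card (W e) \<le> 2 * d + 1"
    "\<And>e f. e \<in> edges H \<Longrightarrow> f \<in> edges H \<Longrightarrow> e \<noteq> f \<Longrightarrow> W e \<inter> W f = {}"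
    using topological_minor_routed[OF dr(2) HG] by blast
  define m n k where "m = real (card (edges H))" and "n = real (card (verts H))"
    and "k = real ((2 * d + 1) * nat \<lfloor>c\<rfloor>)"
  define s where "s = sqrt (c * real d)"
  define N where "N = nat \<lceil>3 * s\<rceil>"
  have cd: "1 \<le> c * real d" using mult_mono[of 1 c 1 "real d"] c d by simp
  then have s1: "1 \<le> s" by (simp add: s_def)
  have s2: "s ^ 2 = c * real d" using cd by (simp add: s_def)
  have N: "3 * s \<le> real N" "real N \<le> 4 * s" using s1 unfolding N_def by linarith+
  have "N \<ge> 1" using N(1) s1 by linarith
  then have "card (edges H) * N ^ 2 \<le> 2 ^ 15 * card (verts H) * N ^ 3
      + (2 * d + 1) * nat \<lfloor>c\<rfloor> * card (edges H)"
    by (intro routed_disjoint_bound[OF dr(1,2) W(1) dr(3)])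
      (use sH W(2,3) in \<open>auto simp: simple_graph_def\<close>)
  then have "real (card (edges H) * N ^ 2) \<le> real (2 ^ 15 * card (verts H) * N ^ 3
      + (2 * d + 1) * nat \<lfloor>c\<rfloor> * card (edges H))" by (rule of_nat_mono)
  then have main: "m * real N ^ 2 \<le> 2 ^ 15 * n * real N ^ 3 + k * m"
    by (simp add: m_def n_def k_def algebra_simps)
  have "k \<le> real (3 * d) * c"
    unfolding k_def of_nat_mult using d c by (intro mult_mono) auto
  also have "\<dots> = 3 * s ^ 2" by (simp add: s2)
  also have "3 * s ^ 2 \<le> real N ^ 2 / 2"
  proof -
    have "9 * s ^ 2 \<le> real N ^ 2" using power_mono[OF N(1), of 2] s1 by (simp add: power_mult_distrib)
    then show ?thesis using zero_le_power2[of s] by linarith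
  qed
  finally have "k * m \<le> real N ^ 2 / 2 * m" by (rule mult_right_mono) (simp add: m_def)
  with main have "real N ^ 2 * m \<le> real N ^ 2 * (2 ^ 16 * n * real N)"
    by (simp add: algebra_simps power2_eq_square power3_eq_cube)
  then have "m \<le> 2 ^ 16 * n * real N" using \<open>N \<ge> 1\<close> by simp
  also have "\<dots> \<le> 2 ^ 16 * n * (4 * s)" using N(2) by (intro mult_left_mono) (auto simp: n_def)
  finally have "m \<le> 2 ^ 18 * s * n" by (simp add: mult_ac)
  moreover have "n > 0" using H sH by (simp add: n_def simple_graph_def card_gt_0_iff)
  ultimately show "ereal (density H) \<le> ereal (2 ^ 18 * sqrt (c * real d))"
    by (simp add: density_def divide_le_eq m_def n_def s_def)
qed

theorem theorem5p3:
  shows "(\<forall>c::real. c \<ge> 1 \<longrightarrow> bounded_expansion (crossing_class c :: 'v ugraph set)) \<and>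
    (\<exists>K::real. \<forall>c::real. c \<ge> 1 \<longrightarrow>
      (\<forall>G \<in> (crossing_class c :: 'v ugraph set). \<forall>d::nat. d \<ge> 1 \<longrightarrow>
        topological_grad d G \<le> ereal (K * sqrt (c * real d))))"
  using crossing_class_bounded_expansion crossing_class_topological_grad by blast

end
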